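(* For every prime power $q$, there exist two Desarguesian projective planes of order $q$ (i.e. each isomorphic to $\mathrm{PG}(2,q)$) on the same point set which are orthogoval.
   Context: Two planes, both projective or both affine, of the same order and on the same point set are called orthogoval if every line of one plane intersects every line of the other plane in at most two points (equivalently, the lines of each are ovals, i.e. sets with no three collinear points, in the other). *)

theory Defs
  imports "HOL-Number_Theory.Number_Theory" "HOL-Algebra.Algebra"
begin

text \<open>
  A plane is given by its point set \<open>P\<close> and its line set \<open>L\<close>, each line being the set of
  points incident with it.
\<close>

definition projective_plane :: "'p set \<Rightarrow> 'p set set \<Rightarrow> bool" where
  "projective_plane P L \<longleftrightarrow>
     (\<forall>l\<in>L. l \<subseteq> P) \<and>
     (\<forall>x\<in>P. \<forall>y\<in>P. x \<noteq> y \<longrightarrow> (\<exists>!l. l \<in> L \<and> x \<in> l \<and> y \<in> l)) \<and>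
     (\<forall>l\<in>L. \<forall>m\<in>L. l \<noteq> m \<longrightarrow> (\<exists>!x. x \<in> l \<and> x \<in> m)) \<and>
     (\<exists>Q. Q \<subseteq> P \<and> card Q = 4 \<and> (\<forall>l\<in>L. card (l \<inter> Q) \<le> 2))"

definition affine_plane :: "'p set \<Rightarrow> 'p set set \<Rightarrow> bool" where
  "affine_plane P L \<longleftrightarrow>
     (\<forall>l\<in>L. l \<subseteq> P) \<and>
     (\<forall>x\<in>P. \<forall>y\<in>P. x \<noteq> y \<longrightarrow> (\<exists>!l. l \<in> L \<and> x \<in> l \<and> y \<in> l)) \<and>
     (\<forall>l\<in>L. \<forall>x\<in>P - l. \<exists>!m. m \<in> L \<and> x \<in> m \<and> l \<inter> m = {}) \<and>
     (\<forall>l\<in>L. l \<noteq> {}) \<and>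
     (\<exists>Q. Q \<subseteq> P \<and> card Q = 3 \<and> (\<forall>l\<in>L. card (l \<inter> Q) \<le> 2))"

definition projective_plane_of_order :: "nat \<Rightarrow> 'p set \<Rightarrow> 'p set set \<Rightarrow> bool" where
  "projective_plane_of_order n P L \<longleftrightarrow>
     projective_plane P L \<and> finite P \<and> (\<forall>l\<in>L. card l = n + 1)"

definition affine_plane_of_order :: "nat \<Rightarrow> 'p set \<Rightarrow> 'p set set \<Rightarrow> bool" where
  "affine_plane_of_order n P L \<longleftrightarrow>
     affine_plane P L \<and> finite P \<and> (\<forall>l\<in>L. card l = n)"

definition orthogoval :: "'p set \<Rightarrow> 'p set set \<Rightarrow> 'p set set \<Rightarrow> bool" where
  "orthogoval P L L' \<longleftrightarrow>
     (\<exists>n. (projective_plane_of_order n P L \<and> projective_plane_of_order n P L') \<or>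
          (affine_plane_of_order n P L \<and> affine_plane_of_order n P L')) \<and>
     (\<forall>l\<in>L. \<forall>m\<in>L'. card (l \<inter> m) \<le> 2)"

definition plane_isomorphic ::
    "'p set \<Rightarrow> 'p set set \<Rightarrow> 'r set \<Rightarrow> 'r set set \<Rightarrow> bool" where
  "plane_isomorphic P L P' L' \<longleftrightarrow> (\<exists>f. bij_betw f P P' \<and> (\<lambda>l. f ` l) ` L = L')"

definition vec3_carrier :: "('a, 'm) ring_scheme \<Rightarrow> ('a \<times> 'a \<times> 'a) set" where
  "vec3_carrier F = carrier F \<times> carrier F \<times> carrier F"

definition vec3_zero :: "('a, 'm) ring_scheme \<Rightarrow> 'a \<times> 'a \<times> 'a" where
  "vec3_zero F = (\<zero>\<^bsub>F\<^esub>, \<zero>\<^bsub>F\<^esub>, \<zero>\<^bsub>F\<^esub>)"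

fun vec3_add ::
    "('a, 'm) ring_scheme \<Rightarrow> 'a \<times> 'a \<times> 'a \<Rightarrow> 'a \<times> 'a \<times> 'a \<Rightarrow> 'a \<times> 'a \<times> 'a" where
  "vec3_add F (x, y, z) (x', y', z') = (x \<oplus>\<^bsub>F\<^esub> x', y \<oplus>\<^bsub>F\<^esub> y', z \<oplus>\<^bsub>F\<^esub> z')"

fun vec3_smult :: "('a, 'm) ring_scheme \<Rightarrow> 'a \<Rightarrow> 'a \<times> 'a \<times> 'a \<Rightarrow> 'a \<times> 'a \<times> 'a" where
  "vec3_smult F c (x, y, z) = (c \<otimes>\<^bsub>F\<^esub> x, c \<otimes>\<^bsub>F\<^esub> y, c \<otimes>\<^bsub>F\<^esub> z)"

definition vec3_span1 :: "('a, 'm) ring_scheme \<Rightarrow> 'a \<times> 'a \<times> 'a \<Rightarrow> ('a \<times> 'a \<times> 'a) set" where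
  "vec3_span1 F u = {vec3_smult F a u | a. a \<in> carrier F}"

definition vec3_span2 ::
    "('a, 'm) ring_scheme \<Rightarrow> 'a \<times> 'a \<times> 'a \<Rightarrow> 'a \<times> 'a \<times> 'a \<Rightarrow> ('a \<times> 'a \<times> 'a) set" where
  "vec3_span2 F u v =
     {vec3_add F (vec3_smult F a u) (vec3_smult F b v) | a b. a \<in> carrier F \<and> b \<in> carrier F}"

definition vec3_indep2 ::
    "('a, 'm) ring_scheme \<Rightarrow> 'a \<times> 'a \<times> 'a \<Rightarrow> 'a \<times> 'a \<times> 'a \<Rightarrow> bool" where
  "vec3_indep2 F u v \<longleftrightarrow>
     (\<forall>a\<in>carrier F. \<forall>b\<in>carrier F.
        vec3_add F (vec3_smult F a u) (vec3_smult F b v) = vec3_zero F \<longrightarrow>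
        a = \<zero>\<^bsub>F\<^esub> \<and> b = \<zero>\<^bsub>F\<^esub>)"

text \<open>
  The points of \<open>PG(2,F)\<close> are the one-dimensional subspaces of \<open>F\<^sup>3\<close>; its lines are the
  two-dimensional subspaces, each taken as the set of the points it contains.
\<close>

definition PG2_points :: "('a, 'm) ring_scheme \<Rightarrow> ('a \<times> 'a \<times> 'a) set set" where
  "PG2_points F = {vec3_span1 F u | u. u \<in> vec3_carrier F \<and> u \<noteq> vec3_zero F}"

definition PG2_lines :: "('a, 'm) ring_scheme \<Rightarrow> ('a \<times> 'a \<times> 'a) set set set" where
  "PG2_lines F =
     {{p \<in> PG2_points F. p \<subseteq> vec3_span2 F u v} | u v.
        u \<in> vec3_carrier F \<and> v \<in> vec3_carrier F \<and> vec3_indep2 F u v}"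

text \<open>
  A finite field is determined up to isomorphism by its order and has a copy whose elements are
  natural numbers, so letting \<open>F\<close> range over fields with carrier in \<^typ>\<open>nat\<close> loses nothing.
\<close>

definition desarguesian_plane_of_order :: "nat \<Rightarrow> 'p set \<Rightarrow> 'p set set \<Rightarrow> bool" where
  "desarguesian_plane_of_order q P L \<longleftrightarrow>
     projective_plane_of_order q P L \<and>
     (\<exists>F :: nat ring. field F \<and> finite (carrier F) \<and> card (carrier F) = q \<and>
        plane_isomorphic P L (PG2_points F) (PG2_lines F))"

end

theory Submission
  imports Defs
begin

text \<open>
  Let \<open>K\<close> be the field with \<open>q\<^sup>3\<close> elements and \<open>k\<close> its subfield with \<open>q\<close> elements. The
  one- and two-dimensional \<open>k\<close>-subspaces of \<open>K\<close> are the points and lines of a plane isomorphic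
  to \<open>PG(2,q)\<close>, and \<open>x \<mapsto> 1/x\<close> permutes its points. The second plane is the image of the first
  under this permutation (in terms of a Singer difference set \<open>D\<close>, the lines are the translates
  of \<open>D\<close> and of \<open>-D\<close>). If a line met the inverse of a line in three points, these could be scaled
  to \<open>u\<close>, \<open>v\<close>, \<open>u + v\<close> with \<open>1/(u + v)\<close> a \<open>k\<close>-combination of \<open>1/u\<close> and \<open>1/v\<close>; clearing
  denominators, \<open>u/v\<close> would be a root outside \<open>k\<close> of a nonzero quadratic polynomial over \<open>k\<close>,
  which is impossible in an extension of degree three.
\<close>

section \<open>Finite fields with a cubic extension\<close>

text \<open>Induction on \<open>n\<close> with Pascal's rule: multiplying the \<open>n\<close>-th
  sum by \<open>x\<close> and by \<open>y\<close> produces the two summands of each new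
  coefficient.\<close>

lemma (in cring) binomial_finsum:
  fixes n :: nat
  assumes "x \<in> carrier R" "y \<in> carrier R"
  shows "(x \<oplus> y) [^] n = (\<Oplus>k\<in>{..n}. add_pow R (n choose k) (x [^] k \<otimes> y [^] (n - k)))"
proof (induction n)
  case 0
  then show ?case using assms by simp
next
  case (Suc n)
  define T where "T k = add_pow R (n choose k) (x [^] k \<otimes> y [^] (n - k))" for k
  define U where "U k = add_pow R (n choose k) (x [^] k \<otimes> y [^] (Suc n - k))" for k
  define V where "V k = add_pow R (Suc n choose k) (x [^] k \<otimes> y [^] (Suc n - k))" for k
  have cl: "T k \<in> carrier R" "U k \<in> carrier R" "V k \<in> carrier R" for k
    using assms by (auto simp: T_def U_def V_def)
  have Ty: "T k \<otimes> y = U k" if "k \<le> n" for k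
    using assms that by (simp add: T_def U_def add_pow_ldistr m_assoc Suc_diff_le)
  have V: "V (Suc k) = T k \<otimes> x \<oplus> U (Suc k)" for k
    using assms by (simp add: T_def U_def V_def add_pow_ldistr add_pow_rdistr add.nat_pow_mult [symmetric] m_ac)
  have V0: "V 0 = U 0" by (simp add: U_def V_def)
  \<comment> \<open>\<open>n choose Suc n\<close> is \<open>0\<close>, so the sum of
    \<open>U\<close> may run up to \<open>Suc n\<close> and match the range of
    \<open>V\<close>.\<close>
  have Ulast: "U (Suc n) = \<zero>" by (simp add: U_def binomial_eq_0 add_pow_def)
  have "(x \<oplus> y) [^] Suc n = (\<Oplus>k\<in>{..n}. T k) \<otimes> (x \<oplus> y)"
    using Suc.IH by (simp add: T_def)
  also have "\<dots> = (\<Oplus>k\<in>{..n}. T k) \<otimes> x \<oplus> (\<Oplus>k\<in>{..n}. T k) \<otimes> y"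
    using assms cl by (simp add: r_distr)
  also have "(\<Oplus>k\<in>{..n}. T k) \<otimes> y = (\<Oplus>k\<in>{..n}. U k)"
    using assms cl Ty by (subst finsum_ldistr) (auto intro!: finsum_cong')
  also have "\<dots> = (\<Oplus>k\<in>{..Suc n}. U k)"
    using cl Ulast by (subst finsum_Suc) auto
  also have "\<dots> = (\<Oplus>k\<in>{..n}. U (Suc k)) \<oplus> U 0"
    using cl by (subst finsum_Suc2) auto
  also have "(\<Oplus>k\<in>{..n}. T k) \<otimes> x = (\<Oplus>k\<in>{..n}. T k \<otimes> x)"
    using assms cl by (subst finsum_ldistr) auto
  also have "(\<Oplus>k\<in>{..n}. T k \<otimes> x) \<oplus> ((\<Oplus>k\<in>{..n}. U (Suc k)) \<oplus> U 0) =
             (\<Oplus>k\<in>{..n}. V (Suc k)) \<oplus> V 0"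
    using assms cl by (simp add: V V0 finsum_addf a_assoc)
  also have "\<dots> = (\<Oplus>k\<in>{..Suc n}. V k)"
    using cl by (subst finsum_Suc2) auto
  finally show ?case by (simp add: V_def)
qed

text \<open>Characteristic \<open>p\<close> is expressed by
  \<open>add_pow R p \<one> = \<zero>\<close>. Since \<open>p\<close> divides every binomial
  coefficient strictly between the ends, only the two end terms of the expansion survive.\<close>

lemma (in cring) frobenius_add:
  fixes p :: nat
  assumes "Factorial_Ring.prime p" "add_pow R p \<one> = \<zero>" and xy: "x \<in> carrier R" "y \<in> carrier R"
  shows "(x \<oplus> y) [^] p = x [^] p \<oplus> y [^] p"
proof -
  define T where "T k = add_pow R (p choose k) (x [^] k \<otimes> y [^] (p - k))" for k
  have cl: "T k \<in> carrier R" for k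
    using xy by (simp add: T_def)
  \<comment> \<open>As \<open>p\<close> is at least 2, the terms at \<open>0\<close> and at
    \<open>p\<close> can both be split off, leaving a sum over \<open>{..m}\<close>.\<close>
  obtain m where m: "p = Suc (Suc m)"
    using prime_ge_2_nat[OF \<open>Factorial_Ring.prime p\<close>] that[of "p - 2"] by simp
  have z: "T k = \<zero>" if "0 < k" "k < p" for k
  proof -
    have "p dvd (p choose k)"
      using \<open>Factorial_Ring.prime p\<close> that by (intro dvd_choose_prime) auto
    then obtain c where c: "p choose k = p * c" by blast
    define w where "w = x [^] k \<otimes> y [^] (p - k)"
    have w: "w \<in> carrier R" using xy by (simp add: w_def)
    have "add_pow R p w = (add_pow R p \<one>) \<otimes> w"
      using w by (simp add: add_pow_ldistr)
    then have "add_pow R p w = \<zero>"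
      using w assms(2) by simp
    moreover have "add_pow R (p * c) w = add_pow R (c) (add_pow R p w)"
      using w by (simp add: add.nat_pow_pow)
    ultimately show ?thesis by (simp add: T_def c w_def [symmetric])
  qed
  have "(x \<oplus> y) [^] p = (\<Oplus>k\<in>{..p}. T k)"
    using xy by (simp add: binomial_finsum T_def)
  also have "\<dots> = T p \<oplus> (\<Oplus>k\<in>{..Suc m}. T k)"
    unfolding m using cl by (subst finsum_Suc) auto
  also have "(\<Oplus>k\<in>{..Suc m}. T k) = (\<Oplus>k\<in>{..m}. T (Suc k)) \<oplus> T 0"
    using cl by (subst finsum_Suc2) auto
  also have "(\<Oplus>k\<in>{..m}. T (Suc k)) = (\<Oplus>k\<in>{..m}. \<zero>)"
    using z m by (intro finsum_cong') auto
  finally show ?thesis using xy by (simp add: T_def)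
qed

lemma (in cring) frobenius_pow_add:
  fixes p e :: nat
  assumes "Factorial_Ring.prime p" "add_pow R p \<one> = \<zero>" and "x \<in> carrier R" "y \<in> carrier R"
  shows "(x \<oplus> y) [^] (p ^ e) = x [^] (p ^ e) \<oplus> y [^] (p ^ e)"
  using assms
  by (induction e) (simp_all add: nat_pow_pow [symmetric] mult.commute[of p] frobenius_add)

text \<open>Derived from additivity rather than from the parity of \<open>p\<close>, so
  \<open>p = 2\<close> is covered as well.\<close>

lemma (in cring) frobenius_pow_minus:
  fixes p e :: nat
  assumes "Factorial_Ring.prime p" "add_pow R p \<one> = \<zero>" and x: "x \<in> carrier R"
  shows "(\<ominus> x) [^] (p ^ e) = \<ominus> (x [^] (p ^ e))"
proof -
  have "x [^] (p ^ e) \<oplus> (\<ominus> x) [^] (p ^ e) = (x \<oplus> \<ominus> x) [^] (p ^ e)"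
    using assms by (simp add: frobenius_pow_add)
  also have "\<dots> = \<zero>"
    using x \<open>Factorial_Ring.prime p\<close> by (simp add: r_neg nat_pow_zero prime_gt_0_nat)
  finally show ?thesis using x by (metis a_comm minus_equality nat_pow_closed a_inv_closed)
qed

text \<open>Powers of Frobenius respect both operations. Inside an algebraic closure, with
  \<open>e\<close> positive, this is the field with \<open>p ^ e\<close> elements.\<close>

lemma (in field) frobenius_fixed_subfield:
  fixes p e :: nat
  assumes "Factorial_Ring.prime p" "add_pow R p \<one> = \<zero>"
  shows "subfield {x \<in> carrier R. x [^] (p ^ e) = x} R"
proof (rule subfieldI')
  show "subring {x \<in> carrier R. x [^] (p ^ e) = x} R"
    using assms by (intro subringI) (auto simp: frobenius_pow_add frobenius_pow_minus nat_pow_distrib)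
next
  fix a assume a: "a \<in> {x \<in> carrier R. x [^] (p ^ e) = x} - {\<zero>}"
  then have u: "a \<in> Units R" by (simp add: field_Units)
  have "a \<otimes> (inv a) [^] (p ^ e) = a [^] (p ^ e) \<otimes> (inv a) [^] (p ^ e)"
    using a by simp
  also have "\<dots> = (a \<otimes> inv a) [^] (p ^ e)"
    using u by (subst nat_pow_distrib) auto
  also have "\<dots> = \<one>" using u by simp
  \<comment> \<open>\<open>inv a\<close> and its power are both inverse to \<open>a\<close>, and
    inverses are unique.\<close>
  finally have "inv a [^] (p ^ e) = inv a"
    using u by (metis Units_closed Units_inv_closed comm_inv_char nat_pow_closed)
  then show "inv a \<in> {x \<in> carrier R. x [^] (p ^ e) = x}"
    using u by simp
qed

section \<open>Counting the roots of X^Q - X\<close>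

text \<open>Coefficients are listed from the highest degree down. The list form settles the degree
  and the field of coefficients; the ring form settles evaluation and factorization.\<close>

lemma (in field) power_minus_var_coeffs:
  fixes Q :: nat
  assumes "Q \<ge> 2"
  defines "P \<equiv> \<one> # replicate (Q - 2) \<zero> @ [\<ominus> \<one>, \<zero>]"
  shows "P = X [^]\<^bsub>poly_ring R\<^esub> Q \<ominus>\<^bsub>poly_ring R\<^esub> X"
proof -
  obtain m where m: "Q = Suc (Suc m)"
    using assms(1) that[of "Q - 2"] by simp
  have X: "X \<in> carrier (poly_ring R)"
    using var_closed(1)[OF carrier_is_subring] .
  have "\<ominus>\<^bsub>poly_ring R\<^esub> X = [\<ominus> \<one>, \<zero>]"
    using univ_poly_a_inv_def'[OF carrier_is_subring X] by (simp add: var_def)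
  moreover have "X [^]\<^bsub>poly_ring R\<^esub> Q = \<one> # replicate Q \<zero>"
    using unitary_monom_eq_var_pow[OF carrier_is_subring, of Q] by (simp add: monom_def)
  moreover have "map2 (\<oplus>) (replicate m \<zero> @ ys) (replicate m \<zero> @ zs) = replicate m \<zero> @ map2 (\<oplus>) ys zs" for ys zs
    by (simp add: zip_append zip_replicate)
  moreover have "replicate (Suc (Suc m)) \<zero> = replicate m \<zero> @ [\<zero>, \<zero>]"
    by (induction m) simp_all
  ultimately show ?thesis
    unfolding P_def a_minus_def univ_poly_add m by simp
qed

text \<open>Used with \<open>x\<close> the polynomial X - a, \<open>y\<close> its power with
  exponent \<open>Q - 1\<close>, and \<open>z\<close> the constant polynomial a.\<close>

lemma (in cring) add_cancel_factor:
  assumes "x \<in> carrier R" "y \<in> carrier R" "z \<in> carrier R"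
  shows "x \<otimes> y \<oplus> z \<ominus> (x \<oplus> z) = x \<otimes> (y \<ominus> \<one>)"
  using assms by (simp add: a_minus_def r_distr r_minus minus_add a_ac r_neg1 r_neg2)

lemma ring_hom_add_pow:
  fixes n :: nat
  assumes "ring_hom_ring R S h" "x \<in> carrier R"
  shows "h (add_pow R n x) = add_pow S n (h x)"
proof -
  interpret ring_hom_ring R S h by fact
  show ?thesis
    using group_hom.hom_nat_pow[OF a_group_hom, of x n] assms(2) by (simp add: add_pow_def)
qed

text \<open>The fixed points are the roots of X^Q - X with \<open>Q = p ^ e\<close>. This polynomial
  splits over the closure, so it has \<open>Q\<close> roots with multiplicity; it remains to see
  that they are simple.\<close>

lemma (in algebraic_closure) card_frobenius_fixed:
  fixes p e :: nat
  assumes p: "Factorial_Ring.prime p" "add_pow L p \<one> = \<zero>" and e: "e > 0"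
  shows "card {x \<in> carrier L. x [^] (p ^ e) = x} = p ^ e"
    and "finite {x \<in> carrier L. x [^] (p ^ e) = x}"
proof -
  define Q where "Q = p ^ e"
  have Q2: "Q \<ge> 2"
    using p(1) e prime_ge_2_nat unfolding Q_def
    by (metis One_nat_def Suc_leI dual_order.trans self_le_power prime_gt_0_nat)
  define P where "P = \<one> # replicate (Q - 2) \<zero> @ [\<ominus> \<one>, \<zero>]"
  have PX: "P = X [^]\<^bsub>poly_ring L\<^esub> Q \<ominus>\<^bsub>poly_ring L\<^esub> X"
    unfolding P_def by (rule power_minus_var_coeffs[OF Q2])
  have sr: "subring K L" by (rule subfieldE(1)[OF subfield_axioms])
  have PK: "P \<in> carrier (K[X])"
    using subringE(2,3)[OF sr] subringE(5)[OF sr, of \<one>]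
    unfolding sym[OF univ_poly_carrier] polynomial_def P_def by (simp add: set_replicate_conv_if)
  then have Pc: "P \<in> carrier (poly_ring L)"
    using carrier_polynomial_shell[OF sr] by simp
  have size: "size (roots P) = Q"
    using roots_over_subfield[OF PK] Q2 unfolding splitted_def by (simp add: P_def)
  interpret UP: domain "poly_ring L"
    using univ_poly_is_domain[OF carrier_is_subring] .
  have X: "X \<in> carrier (poly_ring L)"
    using var_closed(1)[OF carrier_is_subring] .
  have ev: "eval P x = x [^] Q \<ominus> x" if x: "x \<in> carrier L" for x
  proof -
    interpret H: ring_hom_ring "poly_ring L" L "\<lambda>p. eval p x"
      using eval_ring_hom[OF carrier_is_subring x] .
    show ?thesis using X x unfolding PX a_minus_def by (simp add: H.hom_nat_pow eval_var)
  qed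
  have set: "set_mset (roots P) = {x \<in> carrier L. x [^] Q = x}"
  proof -
    have "P \<noteq> []" by (simp add: P_def)
    then have "x \<in># roots P \<longleftrightarrow> x \<in> carrier L \<and> x [^] Q = x" for x
      using roots_mem_iff_is_root[OF Pc] ev r_right_minus_eq unfolding is_root_def by auto
    then show ?thesis by auto
  qed
  text \<open>By Frobenius, \<open>X\<^sup>Q - X = (X - a)\<^sup>Q - (X - a)\<close> for every root \<open>a\<close>, so all roots are simple.\<close>
  have cnt: "count (roots P) a = 1" if "a \<in># roots P" for a
  proof -
    have a: "a \<in> carrier L" "a [^] Q = a" using that set by auto
    define C where "C = [\<one>, \<ominus> a]"
    define c where "c = poly_of_const a"
    interpret E: ring_hom_ring L "poly_ring L" poly_of_const
      using canonical_embedding_ring_hom[OF carrier_is_subring] by simp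
    \<comment> \<open>Frobenius is applied in the polynomial ring itself, so the characteristic is
      carried over along the constants.\<close>
    have charUP: "add_pow (poly_ring L) p \<one>\<^bsub>poly_ring L\<^esub> = \<zero>\<^bsub>poly_ring L\<^esub>"
      using ring_hom_add_pow[OF E.ring_hom_ring_axioms, of \<one> p] p(2) by simp
    have c: "c \<in> carrier (poly_ring L)" "c [^]\<^bsub>poly_ring L\<^esub> Q = c"
      using a E.hom_nat_pow[of a Q] by (simp_all add: c_def)
    have C: "C \<in> carrier (poly_ring L)"
      using a unfolding sym[OF univ_poly_carrier] polynomial_def C_def by simp
    have XC: "X = C \<oplus>\<^bsub>poly_ring L\<^esub> c"
      using a unfolding univ_poly_add C_def c_def by (simp add: poly_of_const_def var_def l_neg)
    define D where "D = C [^]\<^bsub>poly_ring L\<^esub> (Q - 1) \<ominus>\<^bsub>poly_ring L\<^esub> \<one>\<^bsub>poly_ring L\<^esub>"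
    have D: "D \<in> carrier (poly_ring L)" using C by (simp add: D_def)
    have CQ: "C [^]\<^bsub>poly_ring L\<^esub> Q = C \<otimes>\<^bsub>poly_ring L\<^esub> C [^]\<^bsub>poly_ring L\<^esub> (Q - 1)"
      using C Q2 UP.nat_pow_Suc2[of C "Q - 1"] by simp
    have "P = C [^]\<^bsub>poly_ring L\<^esub> Q \<oplus>\<^bsub>poly_ring L\<^esub> c \<ominus>\<^bsub>poly_ring L\<^esub> (C \<oplus>\<^bsub>poly_ring L\<^esub> c)"
      using UP.frobenius_pow_add[OF p(1) charUP C c(1), of e] c(2)
      unfolding PX XC Q_def[symmetric] by simp
    also have "\<dots> = C \<otimes>\<^bsub>poly_ring L\<^esub> D"
      unfolding D_def CQ using UP.add_cancel_factor[OF C UP.nat_pow_closed[OF C] c(1)] .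
    finally have PCD: "P = C \<otimes>\<^bsub>poly_ring L\<^esub> D" .
    have "D \<noteq> []"
    proof
      assume "D = []"
      then have "D = \<zero>\<^bsub>poly_ring L\<^esub>" by (simp add: univ_poly_zero)
      then have "P = \<zero>\<^bsub>poly_ring L\<^esub>" using PCD C by simp
      then show False by (simp add: P_def univ_poly_zero)
    qed
    interpret H: ring_hom_ring "poly_ring L" L "\<lambda>p. eval p a"
      using eval_ring_hom[OF carrier_is_subring a(1)] .
    have "eval C a = \<zero>" using a(1) by (simp add: C_def r_neg)
    \<comment> \<open>\<open>C\<close> vanishes at \<open>a\<close> and the exponent
      \<open>Q - 1\<close> is positive, so only the summand -1 of \<open>D\<close> is left.\<close>
    then have "eval D a = \<ominus> \<one>"
      using C Q2 by (simp add: D_def a_minus_def H.hom_nat_pow nat_pow_zero)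
    then have "\<not> is_root D a"
      by (simp add: is_root_def)
    then have "count (roots D) a = 0"
      using roots_mem_iff_is_root[OF D, of a] not_in_iff by metis
    moreover have "roots P = add_mset a (roots D)"
      unfolding PCD C_def
      by (rule poly_mult_degree_one_monic_imp_same_roots[OF a(1) D \<open>D \<noteq> []\<close>])
    ultimately show ?thesis by simp
  qed
  have "size (roots P) = (\<Sum>a\<in>set_mset (roots P). 1)"
    unfolding size_multiset_overloaded_eq by (rule sum.cong[OF refl cnt])
  then show "card {x \<in> carrier L. x [^] (p ^ e) = x} = p ^ e"
    using size set by (simp add: Q_def)
  show "finite {x \<in> carrier L. x [^] (p ^ e) = x}"
    using set by (metis Q_def finite_set_mset)
qed


section \<open>The fields of orders q and q^3\<close>

text \<open>The map \<open>x [^] q\<close> is the Frobenius automorphism of \<open>R\<close> over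
  \<open>k\<close>. Degree three is encoded by its third iterate being the identity and by the
  cardinality \<open>q ^ 3\<close>, so that dimension arguments become counting arguments.\<close>

locale cubic_extension = field R for R (structure) +
  fixes k :: "'a set" and q :: nat
  assumes subfield_k: "subfield k R"
    and card_k: "card k = q"
    and finite_carrier: "finite (carrier R)"
    and card_carrier: "card (carrier R) = q ^ 3"
    and frob_add: "\<lbrakk>x \<in> carrier R; y \<in> carrier R\<rbrakk> \<Longrightarrow> (x \<oplus> y) [^] q = x [^] q \<oplus> y [^] q"
    and frob_fixed: "x \<in> carrier R \<Longrightarrow> x [^] q = x \<longleftrightarrow> x \<in> k"
    and frob_cubed: "x \<in> carrier R \<Longrightarrow> ((x [^] q) [^] q) [^] q = x"

text \<open>Both fields are cut out of an algebraic closure of the integers mod \<open>p\<close>, as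
  the fixed points of the powers with exponents \<open>p ^ n\<close> and \<open>p ^ (n * 3)\<close>.
  The type of \<open>R\<close> is the one in which the closure of a ring on \<open>int\<close>
  lives.\<close>

lemma cubic_extension_exists:
  fixes q :: nat
  assumes "primepow q"
  shows "\<exists>(R :: ((int list \<times> nat) multiset \<Rightarrow> int) ring) k. cubic_extension R k q"
proof -
  obtain p n where p: "Factorial_Ring.prime p" and n: "n > 0" and q: "q = p ^ n"
    using assms unfolding primepow_def by blast
  interpret Rp: residues_prime p "residue_ring (int p)"
    using p by (simp add: residues_prime_def)
  obtain L :: "((int list \<times> nat) multiset \<Rightarrow> int) ring"
    where L: "algebraic_closure L (Rp.indexed_const ` carrier (residue_ring (int p)))"
      and hom: "Rp.indexed_const \<in> ring_hom (residue_ring (int p)) L"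
    using Rp.exists_closure by blast
  interpret L: algebraic_closure L "Rp.indexed_const ` carrier (residue_ring (int p))"
    by (rule L)
  interpret H: ring_hom_ring "residue_ring (int p)" L Rp.indexed_const
    by (intro ring_hom_ringI2 Rp.ring_axioms L.ring_axioms hom)
  \<comment> \<open>The \<open>m\<close>-fold multiple of one is the residue of \<open>m\<close>, so
    the \<open>p\<close>-fold multiple vanishes.\<close>
  have "add_pow (residue_ring (int p)) m \<one>\<^bsub>residue_ring (int p)\<^esub> = int m mod int p" for m :: nat
  proof (induction m)
    case (Suc m)
    then show ?case
      by (simp add: Rp.res_add_eq Rp.res_one_eq mod_simps add.commute)
  qed (simp add: Rp.res_zero_eq)
  then have "add_pow (residue_ring (int p)) p \<one>\<^bsub>residue_ring (int p)\<^esub> = \<zero>\<^bsub>residue_ring (int p)\<^esub>"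
    by (simp add: Rp.res_zero_eq)
  then have char: "add_pow L p \<one>\<^bsub>L\<^esub> = \<zero>\<^bsub>L\<^esub>"
    using ring_hom_add_pow[OF H.ring_hom_ring_axioms, of "\<one>\<^bsub>residue_ring (int p)\<^esub>" p] by simp
  define K where "K = {x \<in> carrier L. x [^]\<^bsub>L\<^esub> (p ^ (n * 3)) = x}"
  define k where "k = {x \<in> carrier L. x [^]\<^bsub>L\<^esub> (p ^ n) = x}"
  define R where "R = L\<lparr>carrier := K\<rparr>"
  have K: "subfield K L" and k: "subfield k L"
    unfolding K_def k_def by (rule L.frobenius_fixed_subfield[OF p char])+
  interpret R: field R
    unfolding R_def using L.subfield_iff(2)[OF K] .
  \<comment> \<open>Three iterations of the \<open>q\<close>-th power give the exponent
    \<open>p ^ (n * 3)\<close>; this yields both \<open>k \<subseteq> K\<close> and the last axiom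
    of the locale.\<close>
  have cube: "((x [^]\<^bsub>L\<^esub> q) [^]\<^bsub>L\<^esub> q) [^]\<^bsub>L\<^esub> q = x [^]\<^bsub>L\<^esub> (p ^ (n * 3))" if "x \<in> carrier L" for x
    using that by (simp add: L.nat_pow_pow q power_mult power3_eq_cube mult.assoc)
  have kK: "k \<subseteq> K"
    by (auto simp: k_def K_def simp flip: cube q)
  have pow: "x [^]\<^bsub>R\<^esub> m = x [^]\<^bsub>L\<^esub> m" for x and m :: nat
    unfolding R_def by (simp flip: L.nat_pow_consistent)
  have "cubic_extension R k q"
  proof (intro cubic_extension.intro cubic_extension_axioms.intro R.field_axioms)
    show "subfield k R"
    proof (rule R.subfield_iff(1))
      show "field (R\<lparr>carrier := k\<rparr>)"
        using L.subfield_iff(2)[OF k] by (simp add: R_def)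
    qed (use kK in \<open>simp add: R_def\<close>)
    show "card k = q"
      using L.card_frobenius_fixed(1)[OF p char n] by (simp add: k_def q)
    show "finite (carrier R)"
      using L.card_frobenius_fixed(2)[OF p char, of "n * 3"] n by (simp add: K_def R_def)
    show "card (carrier R) = q ^ 3"
      using L.card_frobenius_fixed(1)[OF p char, of "n * 3"] n by (simp add: K_def R_def q power_mult)
  next
    fix x y assume "x \<in> carrier R" "y \<in> carrier R"
    then show "(x \<oplus>\<^bsub>R\<^esub> y) [^]\<^bsub>R\<^esub> q = x [^]\<^bsub>R\<^esub> q \<oplus>\<^bsub>R\<^esub> y [^]\<^bsub>R\<^esub> q"
      unfolding pow using L.frobenius_pow_add[OF p char, of x y n] by (simp add: R_def K_def q)
  next
    fix x assume x: "x \<in> carrier R"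
    then show "x [^]\<^bsub>R\<^esub> q = x \<longleftrightarrow> x \<in> k"
      unfolding pow by (simp add: R_def K_def k_def q)
    show "((x [^]\<^bsub>R\<^esub> q) [^]\<^bsub>R\<^esub> q) [^]\<^bsub>R\<^esub> q = x"
      unfolding pow using x cube by (simp add: R_def K_def)
  qed
  then show ?thesis by blast
qed

section \<open>The projective plane of a cubic extension\<close>

context cubic_extension
begin

section \<open>Arithmetic of \<open>k\<close> and quadratic equations over it\<close>

lemma k_carrier [simp]: "a \<in> k \<Longrightarrow> a \<in> carrier R"
  using subfieldE(3)[OF subfield_k] by blast

lemma k_closed [simp]:
  "\<zero> \<in> k" "\<one> \<in> k"
  "\<lbrakk>a \<in> k; b \<in> k\<rbrakk> \<Longrightarrow> a \<oplus> b \<in> k"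
  "\<lbrakk>a \<in> k; b \<in> k\<rbrakk> \<Longrightarrow> a \<otimes> b \<in> k"
  "a \<in> k \<Longrightarrow> \<ominus> a \<in> k"
  using subringE(2,3,5,6,7)[OF subfieldE(1)[OF subfield_k]] by auto

lemma k_minus [simp]: "\<lbrakk>a \<in> k; b \<in> k\<rbrakk> \<Longrightarrow> a \<ominus> b \<in> k"
  by (simp add: a_minus_def)

lemma k_inv [simp]: "\<lbrakk>a \<in> k; a \<noteq> \<zero>\<rbrakk> \<Longrightarrow> inv a \<in> k"
  using subfield_m_inv(1)[OF subfield_k, of a] by simp

lemma nz_inv [simp]:
  assumes "x \<in> carrier R" "x \<noteq> \<zero>"
  shows "inv x \<in> carrier R" "inv x \<noteq> \<zero>" "x \<otimes> inv x = \<one>" "inv x \<otimes> x = \<one>" "inv (inv x) = x"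
proof -
  have u: "x \<in> Units R" using assms by (simp add: field_Units)
  then show "inv x \<in> carrier R" "x \<otimes> inv x = \<one>" "inv x \<otimes> x = \<one>" "inv (inv x) = x"
    by simp_all
  show "inv x \<noteq> \<zero>"
    using Units_inv_Units[OF u] by (simp add: field_Units)
qed

lemma nz_inv_cancel [simp]:
  assumes "x \<in> carrier R" "x \<noteq> \<zero>" "y \<in> carrier R"
  shows "inv x \<otimes> (x \<otimes> y) = y" "x \<otimes> (inv x \<otimes> y) = y"
  using assms by (simp_all add: m_assoc [symmetric])

lemma nz_inv_mult:
  assumes "x \<in> carrier R" "x \<noteq> \<zero>" "y \<in> carrier R" "y \<noteq> \<zero>"
  shows "inv (x \<otimes> y) = inv x \<otimes> inv y"
proof (rule comm_inv_char)
  show "x \<otimes> y \<otimes> (inv x \<otimes> inv y) = \<one>"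
    using assms m_lcomm[of "inv x" y "inv y"] by (simp add: m_assoc)
qed (use assms in auto)

lemma finite_k: "finite k"
  using finite_carrier finite_subset[of k] k_carrier by blast

lemma q_ge_2: "q \<ge> 2"
proof -
  have "card {\<zero>, \<one>} \<le> card k"
    by (intro card_mono finite_k) auto
  then show ?thesis by (simp add: card_k)
qed

text \<open>Frobenius fixes the coefficients and so permutes the roots, while a nonzero quadratic
  polynomial has at most two roots.\<close>

lemma quadratic_over_k_trivial:
  assumes t: "t \<in> carrier R" "t \<notin> k" and k: "a \<in> k" "b \<in> k" "c \<in> k"
    and root: "a \<otimes> (t \<otimes> t) \<oplus> b \<otimes> t \<oplus> c = \<zero>"
  shows "a = \<zero>" "b = \<zero>" "c = \<zero>"
proof -
  have fk: "x [^] q = x" if "x \<in> k" for x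
    using that by (simp add: frob_fixed)
  have frob_root: "a \<otimes> (s [^] q \<otimes> s [^] q) \<oplus> b \<otimes> s [^] q \<oplus> c = \<zero>"
    if "s \<in> carrier R" "a \<otimes> (s \<otimes> s) \<oplus> b \<otimes> s \<oplus> c = \<zero>" for s
  proof -
    have "(a \<otimes> (s \<otimes> s) \<oplus> b \<otimes> s \<oplus> c) [^] q = a \<otimes> (s [^] q \<otimes> s [^] q) \<oplus> b \<otimes> s [^] q \<oplus> c"
      using that(1) k by (simp add: frob_add nat_pow_distrib fk)
    then show ?thesis using that(2) fk[of \<zero>] by simp
  qed
  have two_roots: "a \<otimes> (s \<oplus> r) \<oplus> b = \<zero>"
    if s: "s \<in> carrier R" "a \<otimes> (s \<otimes> s) \<oplus> b \<otimes> s \<oplus> c = \<zero>"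
      and r: "r \<in> carrier R" "a \<otimes> (r \<otimes> r) \<oplus> b \<otimes> r \<oplus> c = \<zero>" and "s \<noteq> r" for s r
  proof -
    have c: "a \<in> carrier R" "b \<in> carrier R" "c \<in> carrier R" using k by auto
    \<comment> \<open>The difference of the two equations is divisible by
      \<open>s \<ominus> r\<close>, which can be cancelled.\<close>
    have "(s \<ominus> r) \<otimes> (a \<otimes> (s \<oplus> r) \<oplus> b) =
      (a \<otimes> (s \<otimes> s) \<oplus> b \<otimes> s \<oplus> c) \<ominus> (a \<otimes> (r \<otimes> r) \<oplus> b \<otimes> r \<oplus> c)"
      using c s(1) r(1) by algebra
    also have "\<dots> = \<zero>" using s r by (simp add: a_minus_def)
    finally show ?thesis
      using c s(1) r(1) \<open>s \<noteq> r\<close> by (metis a_closed integral m_closed minus_closed r_right_minus_eq)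
  qed
  text \<open>The conjugates \<open>t\<close>, \<open>t\<^sup>q\<close>, \<open>t\<^sup>q\<^sup>2\<close> would be three distinct roots.\<close>
  define t1 where "t1 = t [^] q"
  define t2 where "t2 = t1 [^] q"
  have c: "t1 \<in> carrier R" "t2 \<in> carrier R" using t by (auto simp: t1_def t2_def)
  have cyc: "t2 [^] q = t" using t by (simp add: t1_def t2_def frob_cubed)
  have d1: "t \<noteq> t1" using t frob_fixed[of t] by (simp add: t1_def eq_commute[of t])
  \<comment> \<open>Any coincidence with \<open>t2\<close> would give \<open>t2 [^] q = t1\<close>,
    whereas the cycle closes with \<open>t2 [^] q = t\<close>.\<close>
  have d2: "t1 \<noteq> t2"
  proof
    assume "t1 = t2"
    then have "t2 [^] q = t1" by (simp add: t2_def)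
    then show False using cyc d1 by simp
  qed
  have d3: "t \<noteq> t2"
  proof
    assume "t = t2"
    then have "t2 [^] q = t1" by (simp add: t1_def)
    then show False using cyc d1 by simp
  qed
  have r1: "a \<otimes> (t1 \<otimes> t1) \<oplus> b \<otimes> t1 \<oplus> c = \<zero>"
    unfolding t1_def by (rule frob_root[OF t(1) root])
  have r2: "a \<otimes> (t2 \<otimes> t2) \<oplus> b \<otimes> t2 \<oplus> c = \<zero>"
    unfolding t2_def by (rule frob_root[OF c(1) r1])
  have e1: "a \<otimes> (t1 \<oplus> t) \<oplus> b = \<zero>" and e2: "a \<otimes> (t2 \<oplus> t) \<oplus> b = \<zero>"
    using two_roots[OF c(1) r1 t(1) root] two_roots[OF c(2) r2 t(1) root] d1 d3 by auto
  have kc: "a \<in> carrier R" "b \<in> carrier R" "c \<in> carrier R" using k by auto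
  \<comment> \<open>The two relations share the root \<open>t\<close>; subtracting them isolates
    \<open>a\<close>.\<close>
  have "a \<otimes> (t1 \<ominus> t2) = (a \<otimes> (t1 \<oplus> t) \<oplus> b) \<ominus> (a \<otimes> (t2 \<oplus> t) \<oplus> b)"
    using kc c t(1) by algebra
  also have "\<dots> = \<zero>" using e1 e2 by (simp add: a_minus_def)
  finally show "a = \<zero>"
    using d2 c kc by (metis integral minus_closed r_right_minus_eq)
  then show "b = \<zero>" using e1 t c kc by simp
  then show "c = \<zero>" using \<open>a = \<zero>\<close> root t kc by simp
qed

section \<open>Points, lines and spans as \<open>k\<close>-subspaces\<close>

text \<open>Zero belongs to the set, so for nonzero \<open>x\<close> this is a one-dimensional
  \<open>k\<close>-subspace, and incidence becomes inclusion.\<close>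

definition point :: "'a \<Rightarrow> 'a set" where
  "point x = {a \<otimes> x | a. a \<in> k}"

definition Points :: "'a set set" where
  "Points = point ` (carrier R - {\<zero>})"

definition subsp :: "'a set \<Rightarrow> bool" where
  "subsp A \<longleftrightarrow> A \<subseteq> carrier R \<and> \<zero> \<in> A \<and> (\<forall>x\<in>A. \<forall>y\<in>A. x \<oplus> y \<in> A) \<and> (\<forall>a\<in>k. \<forall>x\<in>A. a \<otimes> x \<in> A)"

definition points_in :: "'a set \<Rightarrow> 'a set set" where
  "points_in A = {p \<in> Points. p \<subseteq> A}"

text \<open>A \<open>k\<close>-subspace has dimension two exactly when it has \<open>q ^ 2\<close>
  elements; dimension is expressed by cardinality.\<close>

definition Lines :: "'a set set set" where
  "Lines = {points_in A | A. subsp A \<and> card A = q ^ 2}"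

definition span2 :: "'a \<Rightarrow> 'a \<Rightarrow> 'a set" where
  "span2 x y = {a \<otimes> x \<oplus> b \<otimes> y | a b. a \<in> k \<and> b \<in> k}"

definition indep :: "'a \<Rightarrow> 'a \<Rightarrow> bool" where
  "indep x y \<longleftrightarrow> (\<forall>a\<in>k. \<forall>b\<in>k. a \<otimes> x \<oplus> b \<otimes> y = \<zero> \<longrightarrow> a = \<zero> \<and> b = \<zero>)"

lemma subspD:
  assumes "subsp A"
  shows "A \<subseteq> carrier R" "x \<in> A \<Longrightarrow> x \<in> carrier R" "\<zero> \<in> A"
    "\<lbrakk>x \<in> A; y \<in> A\<rbrakk> \<Longrightarrow> x \<oplus> y \<in> A" "\<lbrakk>a \<in> k; x \<in> A\<rbrakk> \<Longrightarrow> a \<otimes> x \<in> A"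
  using assms by (auto simp: subsp_def)

lemma subsp_diff: "\<lbrakk>subsp A; x \<in> A; y \<in> A\<rbrakk> \<Longrightarrow> x \<ominus> y \<in> A"
  using subspD(4)[of A x "\<ominus> \<one> \<otimes> y"] subspD(5)[of A "\<ominus> \<one>" y] subspD(2)[of A]
  by (simp add: l_minus a_minus_def)

lemma finite_subsp: "subsp A \<Longrightarrow> finite A"
  using finite_carrier finite_subset subspD(1) by blast

lemma point_self: "x \<in> carrier R \<Longrightarrow> x \<in> point x"
  unfolding point_def by (rule CollectI, rule exI[of _ \<one>]) simp

lemma point_carrier: "x \<in> carrier R \<Longrightarrow> point x \<subseteq> carrier R"
  by (auto simp: point_def)

lemma point_subset: "\<lbrakk>subsp A; x \<in> A\<rbrakk> \<Longrightarrow> point x \<subseteq> A"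
  by (auto simp: point_def subspD)

text \<open>The scalar relating \<open>x\<close> to \<open>y\<close> is nonzero, hence invertible in
  \<open>k\<close>, so each vector is a multiple of the other.\<close>

lemma point_eqI:
  assumes x: "x \<in> point y" "x \<noteq> \<zero>" and y: "y \<in> carrier R"
  shows "point x = point y"
proof -
  obtain a where a: "a \<in> k" "x = a \<otimes> y" using x by (auto simp: point_def)
  have "a \<noteq> \<zero>" using a x y by auto
  have "b \<otimes> x \<in> point y" if "b \<in> k" for b
    using that a y by (auto simp: point_def m_assoc [symmetric] intro!: exI[of _ "b \<otimes> a"])
  moreover have "b \<otimes> y \<in> point x" if "b \<in> k" for b
  proof -
    have "b \<otimes> y = (b \<otimes> inv a) \<otimes> x"
      using that a y \<open>a \<noteq> \<zero>\<close> by (simp add: m_assoc)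
    then show ?thesis using that a \<open>a \<noteq> \<zero>\<close> by (auto simp: point_def)
  qed
  ultimately show ?thesis by (auto simp: point_def)
qed

text \<open>Translates incidence into membership of a representative, so that incidence arguments
  can be made with vectors.\<close>

lemma point_in_points_in: "\<lbrakk>subsp A; x \<in> carrier R; x \<noteq> \<zero>\<rbrakk> \<Longrightarrow> point x \<in> points_in A \<longleftrightarrow> x \<in> A"
  using point_self point_subset by (auto simp: points_in_def Points_def)

lemma card_point_le: "card (point x) \<le> q"
proof -
  have "point x = (\<lambda>a. a \<otimes> x) ` k" by (auto simp: point_def)
  then show ?thesis using card_image_le[OF finite_k] card_k by metis
qed

lemma sp2I: "\<lbrakk>a \<in> k; b \<in> k\<rbrakk> \<Longrightarrow> a \<otimes> x \<oplus> b \<otimes> y \<in> span2 x y"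
  by (auto simp: span2_def)

lemma subsp_span2: "\<lbrakk>x \<in> carrier R; y \<in> carrier R\<rbrakk> \<Longrightarrow> subsp (span2 x y)"
  unfolding subsp_def
proof (intro conjI ballI)
  assume c: "x \<in> carrier R" "y \<in> carrier R"
  show "span2 x y \<subseteq> carrier R" using c by (auto simp: span2_def)
  show "\<zero> \<in> span2 x y" unfolding span2_def using c by (intro CollectI exI[of _ \<zero>]) simp
  fix u assume "u \<in> span2 x y"
  then obtain a b where u: "u = a \<otimes> x \<oplus> b \<otimes> y" "a \<in> k" "b \<in> k" by (auto simp: span2_def)
  {
    fix v assume "v \<in> span2 x y"
    then obtain a' b' where v: "v = a' \<otimes> x \<oplus> b' \<otimes> y" "a' \<in> k" "b' \<in> k" by (auto simp: span2_def)
    have "u \<oplus> v = (a \<oplus> a') \<otimes> x \<oplus> (b \<oplus> b') \<otimes> y"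
      using u v c by (simp add: l_distr a_ac)
    then show "u \<oplus> v \<in> span2 x y" using u(2,3) v(2,3) by (simp add: sp2I)
  next
    fix d assume d: "d \<in> k"
    then have "d \<otimes> u = (d \<otimes> a) \<otimes> x \<oplus> (d \<otimes> b) \<otimes> y"
      using u c by (simp add: r_distr m_assoc)
    then show "d \<otimes> u \<in> span2 x y" using u(2,3) d by (simp add: sp2I)
  }
qed

lemma span2_gens:
  assumes "x \<in> carrier R" "y \<in> carrier R"
  shows "x \<in> span2 x y" "y \<in> span2 x y"
proof -
  have "x = \<one> \<otimes> x \<oplus> \<zero> \<otimes> y" "y = \<zero> \<otimes> x \<oplus> \<one> \<otimes> y" using assms by simp_all
  then show "x \<in> span2 x y" "y \<in> span2 x y" unfolding span2_def using k_closed(1,2) by blast+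
qed

lemma span2_subset: "\<lbrakk>subsp A; x \<in> A; y \<in> A\<rbrakk> \<Longrightarrow> span2 x y \<subseteq> A"
  by (auto simp: span2_def subspD)

lemma span2_image: "span2 x y = (\<lambda>(a, b). a \<otimes> x \<oplus> b \<otimes> y) ` (k \<times> k)"
  by (auto simp: span2_def)

lemma card_span2_le: "card (span2 x y) \<le> q ^ 2"
  unfolding span2_image
  using card_image_le[of "k \<times> k"] finite_k by (simp add: card_cartesian_product card_k power2_eq_square)

lemma indep_eqD:
  assumes "indep x y" "x \<in> carrier R" "y \<in> carrier R" "a \<in> k" "b \<in> k" "a' \<in> k" "b' \<in> k"
    and eq: "a \<otimes> x \<oplus> b \<otimes> y = a' \<otimes> x \<oplus> b' \<otimes> y"
  shows "a = a'" "b = b'"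
proof -
  have kc: "a \<in> carrier R" "b \<in> carrier R" "a' \<in> carrier R" "b' \<in> carrier R" using assms by auto
  have "(a \<ominus> a') \<otimes> x \<oplus> (b \<ominus> b') \<otimes> y = (a \<otimes> x \<oplus> b \<otimes> y) \<ominus> (a' \<otimes> x \<oplus> b' \<otimes> y)"
    using kc assms(2,3) by algebra
  also have "\<dots> = \<zero>" using kc assms(2,3) by (simp add: eq a_minus_def r_neg)
  finally have "a \<ominus> a' = \<zero> \<and> b \<ominus> b' = \<zero>"
    using assms(1)[unfolded indep_def, rule_format, of "a \<ominus> a'" "b \<ominus> b'"] assms(4-7)
    by (simp del: r_right_minus_eq)
  then show "a = a'" "b = b'" using kc r_right_minus_eq by blast+
qed

lemma indep_nz:
  assumes "indep x y" "x \<in> carrier R" "y \<in> carrier R"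
  shows "x \<noteq> \<zero>" "y \<noteq> \<zero>"
proof -
  have "a = \<zero> \<and> b = \<zero>" if "a \<in> k" "b \<in> k" "a \<otimes> x \<oplus> b \<otimes> y = \<zero>" for a b
    using that assms(1) unfolding indep_def by blast
  from this[of \<one> \<zero>] this[of \<zero> \<one>] show "x \<noteq> \<zero>" "y \<noteq> \<zero>"
    using assms(2,3) by auto
qed

lemma indepI:
  assumes "x \<in> carrier R" "y \<in> carrier R" "y \<noteq> \<zero>" "x \<notin> point y"
  shows "indep x y"
  unfolding indep_def
proof (intro ballI impI)
  fix a b assume ab: "a \<in> k" "b \<in> k" and eq: "a \<otimes> x \<oplus> b \<otimes> y = \<zero>"
  have "a = \<zero>"
  proof (rule ccontr)
    assume "a \<noteq> \<zero>"
    have "a \<otimes> x = \<ominus> (b \<otimes> y)" using ab eq assms by (simp add: minus_equality)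
    then have "inv a \<otimes> (a \<otimes> x) = (inv a \<otimes> (\<ominus> b)) \<otimes> y"
      using ab assms \<open>a \<noteq> \<zero>\<close> by (simp add: l_minus r_minus m_assoc)
    then have "x = (inv a \<otimes> (\<ominus> b)) \<otimes> y" using ab assms \<open>a \<noteq> \<zero>\<close> by simp
    then have "x \<in> point y" using ab \<open>a \<noteq> \<zero>\<close> by (auto simp: point_def)
    with assms show False by simp
  qed
  moreover have "b = \<zero>" using eq ab assms \<open>a = \<zero>\<close> integral[of b y] by simp
  ultimately show "a = \<zero> \<and> b = \<zero>" ..
qed

lemma indep_points_in:
  "\<lbrakk>x \<in> carrier R; y \<in> carrier R; y \<noteq> \<zero>; point x \<noteq> point y; x \<noteq> \<zero>\<rbrakk> \<Longrightarrow> indep x y"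
  using indepI point_eqI by blast

lemma card_span2:
  assumes "indep x y" "x \<in> carrier R" "y \<in> carrier R"
  shows "card (span2 x y) = q ^ 2"
proof -
  have "inj_on (\<lambda>(a, b). a \<otimes> x \<oplus> b \<otimes> y) (k \<times> k)"
    using indep_eqD[OF assms] by (auto intro!: inj_onI)
  then show ?thesis
    unfolding span2_image by (simp add: card_image card_cartesian_product card_k power2_eq_square)
qed

text \<open>Stands in for the dimension argument: the span already has \<open>q ^ 2\<close>
  elements. The bound is an inequality so that \<open>A\<close> may also be the span of possibly
  dependent vectors.\<close>

lemma subsp_eq_span2:
  assumes "subsp A" "card A \<le> q ^ 2" "x \<in> A" "y \<in> A" "indep x y"
  shows "A = span2 x y"
  using card_seteq[OF finite_subsp[OF assms(1)] span2_subset[OF assms(1,3,4)]] assms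
    card_span2[OF assms(5)] subspD(2)[OF assms(1)] by auto

text \<open>A point has at most \<open>q\<close> elements, fewer than \<open>q ^ 2\<close>, so a
  second generator exists outside the point of the first.\<close>

lemma subsp_gens:
  assumes "subsp A" "card A = q ^ 2"
  obtains x y where "x \<in> A" "y \<in> A" "indep x y" "A = span2 x y"
proof -
  have q: "1 < q" "q < q ^ 2" using q_ge_2 by (auto simp: power2_eq_square)
  have "\<not> A \<subseteq> {\<zero>}"
    using card_mono[of "{\<zero>}" A] q assms(2) by auto
  then obtain y where y: "y \<in> A" "y \<noteq> \<zero>" by blast
  have yc: "y \<in> carrier R" using subspD(2)[OF assms(1)] y by blast
  have "\<not> A \<subseteq> point y"
    using card_mono[of "point y" A] finite_subset[OF point_carrier[OF yc] finite_carrier]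
      card_point_le[of y] q assms(2) by auto
  then obtain x where x: "x \<in> A" "x \<notin> point y" by blast
  have "indep x y" using indepI x y subspD(2)[OF assms(1)] by blast
  then show ?thesis
    using assms(2) by (intro that[OF x(1) y(1)] subsp_eq_span2[OF assms(1) _ x(1) y(1)]) simp_all
qed

lemma subsp_meet:
  assumes A: "subsp A" "card A = q ^ 2" and B: "subsp B" "card B = q ^ 2"
  shows "\<exists>z. z \<in> A \<and> z \<in> B \<and> z \<noteq> \<zero>"
proof (rule ccontr)
  assume "\<not> ?thesis"
  then have triv: "z = \<zero>" if "z \<in> A" "z \<in> B" for z using that by blast
  text \<open>Otherwise \<open>A \<oplus> B\<close> would have \<open>q\<^sup>4\<close> elements.\<close>
  have "inj_on (\<lambda>(a, b). a \<oplus> b) (A \<times> B)"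
  proof (rule inj_onI, clarify)
    fix a b a' b' assume el: "a \<in> A" "b \<in> B" "a' \<in> A" "b' \<in> B" and eq: "a \<oplus> b = a' \<oplus> b'"
    have c: "a \<in> carrier R" "b \<in> carrier R" "a' \<in> carrier R" "b' \<in> carrier R"
      using el subspD(2) A B by blast+
    have "a \<ominus> a' = (a \<oplus> b) \<ominus> (a' \<oplus> b)" using c by algebra
    also have "\<dots> = b' \<ominus> b" unfolding eq using c by algebra
    finally have e: "a \<ominus> a' = b' \<ominus> b" .
    then have "a \<ominus> a' = \<zero>" using triv[of "a \<ominus> a'"] subsp_diff A B el by metis
    then show "a = a' \<and> b = b'" using e c r_right_minus_eq by metis
  qed
  then have "card (A \<times> B) \<le> card (carrier R)"
    by (rule card_inj_on_le[OF _ _ finite_carrier]) (use subspD(2)[OF A(1)] subspD(2)[OF B(1)] in auto)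
  then have "q ^ 4 \<le> q ^ 3"
    by (simp add: card_cartesian_product A B card_carrier flip: power_add)
  then show False using q_ge_2 power_strict_increasing[of 3 4 q] by simp
qed

section \<open>The axioms of a projective plane of order q\<close>

lemma PtsE:
  assumes "p \<in> Points"
  obtains x where "x \<in> carrier R" "x \<noteq> \<zero>" "p = point x"
  using assms by (auto simp: Points_def)

lemma point_in_Points: "\<lbrakk>x \<in> carrier R; x \<noteq> \<zero>\<rbrakk> \<Longrightarrow> point x \<in> Points"
  by (auto simp: Points_def)

text \<open>Representatives of distinct points are independent, and their span is the only subspace
  with \<open>q ^ 2\<close> elements that contains both.\<close>

lemma unique_line:
  assumes p: "p \<in> Points" and p': "p' \<in> Points" and ne: "p \<noteq> p'"
  shows "\<exists>!l. l \<in> Lines \<and> p \<in> l \<and> p' \<in> l"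
proof -
  obtain x where x: "x \<in> carrier R" "x \<noteq> \<zero>" "p = point x" using p by (rule PtsE)
  obtain y where y: "y \<in> carrier R" "y \<noteq> \<zero>" "p' = point y" using p' by (rule PtsE)
  have ind: "indep x y" using indep_points_in x y ne by blast
  show ?thesis
  proof (rule ex1I)
    show "points_in (span2 x y) \<in> Lines \<and> p \<in> points_in (span2 x y) \<and> p' \<in> points_in (span2 x y)"
      using x y span2_gens[OF x(1) y(1)] subsp_span2[OF x(1) y(1)] card_span2[OF ind x(1) y(1)]
      by (auto simp: Lines_def point_in_points_in)
  next
    fix l assume l: "l \<in> Lines \<and> p \<in> l \<and> p' \<in> l"
    then obtain A where A: "subsp A" "card A = q ^ 2" "l = points_in A" by (auto simp: Lines_def)
    have "x \<in> A" "y \<in> A" using l point_in_points_in[OF A(1)] A(3) x y by auto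
    then show "l = points_in (span2 x y)"
      using subsp_eq_span2[OF A(1) _ _ _ ind] A(2,3) by simp
  qed
qed

lemma unique_point:
  assumes l: "l \<in> Lines" and m: "m \<in> Lines" and ne: "l \<noteq> m"
  shows "\<exists>!p. p \<in> l \<and> p \<in> m"
proof -
  obtain A where A: "subsp A" "card A = q ^ 2" "l = points_in A" using l by (auto simp: Lines_def)
  obtain B where B: "subsp B" "card B = q ^ 2" "m = points_in B" using m by (auto simp: Lines_def)
  obtain z where z: "z \<in> A" "z \<in> B" "z \<noteq> \<zero>" using subsp_meet[OF A(1,2) B(1,2)] by blast
  have zc: "z \<in> carrier R" using subspD(2)[OF A(1) z(1)] .
  show ?thesis
  proof (rule ex1I)
    show "point z \<in> l \<and> point z \<in> m"
      using point_in_points_in[OF A(1) zc z(3)] point_in_points_in[OF B(1) zc z(3)] z A(3) B(3) by simp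
  next
    fix p assume p: "p \<in> l \<and> p \<in> m"
    then have "p \<in> Points" by (simp add: A(3) points_in_def)
    \<comment> \<open>A second common point would make the two lines equal, by uniqueness of the
      joining line.\<close>
    then show "p = point z"
      using unique_line[of p "point z"] point_in_Points[OF zc z(3)] p l m ne
        point_in_points_in[OF A(1) zc z(3)] point_in_points_in[OF B(1) zc z(3)] z A(3) B(3) by metis
  qed
qed

text \<open>Dividing by the coefficient at \<open>y\<close> where it is nonzero, each point is
  either \<open>point x\<close> or the point of \<open>y \<oplus> a \<otimes> x\<close> for exactly
  one \<open>a\<close> in \<open>k\<close>.\<close>

lemma card_line:
  assumes "l \<in> Lines"
  shows "card l = q + 1"
proof -
  obtain A where A: "subsp A" "card A = q ^ 2" "l = points_in A" using assms by (auto simp: Lines_def)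
  obtain x y where g: "x \<in> A" "y \<in> A" "indep x y" "A = span2 x y"
    using subsp_gens[OF A(1,2)] .
  have c: "x \<in> carrier R" "y \<in> carrier R" using subspD(2)[OF A(1)] g by auto
  note nz = indep_nz[OF g(3) c]
  define f where "f a = point (y \<oplus> a \<otimes> x)" for a
  have ynz: "y \<oplus> a \<otimes> x \<noteq> \<zero>" if "a \<in> k" for a
  proof
    assume "y \<oplus> a \<otimes> x = \<zero>"
    then have "a \<otimes> x \<oplus> \<one> \<otimes> y = \<zero> \<otimes> x \<oplus> \<zero> \<otimes> y" using that c by (simp add: a_comm)
    from indep_eqD(2)[OF g(3) c _ _ _ _ this] that show False by simp
  qed
  have fI: "a \<in> k \<Longrightarrow> f a \<in> l" for a
    unfolding f_def A(3) using point_in_points_in[OF A(1), of "y \<oplus> a \<otimes> x"] ynz c g subspD(4,5)[OF A(1)] by simp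
  have "l = insert (point x) (f ` k)"
  proof
    show "insert (point x) (f ` k) \<subseteq> l"
      using fI point_in_points_in[OF A(1) c(1) nz(1)] g A(3) by auto
    show "l \<subseteq> insert (point x) (f ` k)"
    proof
      fix p assume p: "p \<in> l"
      then obtain z where z: "z \<in> carrier R" "z \<noteq> \<zero>" "p = point z"
        using A(3) by (auto simp: points_in_def elim: PtsE)
      then have "z \<in> span2 x y" using p point_in_points_in[OF A(1)] A(3) g(4) by simp
      then obtain a b where ab: "z = a \<otimes> x \<oplus> b \<otimes> y" "a \<in> k" "b \<in> k" by (auto simp: span2_def)
      show "p \<in> insert (point x) (f ` k)"
      proof (cases "b = \<zero>")
        case True
        then have "z \<in> point x" using ab c by (auto simp: point_def)
        then show ?thesis using point_eqI[OF _ z(2) c(1)] z(3) by simp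
      next
        case False
        have "z = b \<otimes> (y \<oplus> (inv b \<otimes> a) \<otimes> x)"
          using ab c False by (simp add: r_distr m_assoc a_comm)
        then have "z \<in> point (y \<oplus> (inv b \<otimes> a) \<otimes> x)" using ab by (auto simp: point_def)
        then have "p = f (inv b \<otimes> a)"
          unfolding f_def z(3) by (rule point_eqI[OF _ z(2)]) (use ab c False in simp)
        then show ?thesis using ab False by simp
      qed
    qed
  qed
  moreover have "inj_on f k"
  proof (rule inj_onI)
    fix a b assume ab: "a \<in> k" "b \<in> k" "f a = f b"
    have "y \<oplus> a \<otimes> x \<in> f b"
      unfolding ab(3)[symmetric] unfolding f_def using ab c by (intro point_self) simp
    then obtain d where d: "d \<in> k" "y \<oplus> a \<otimes> x = d \<otimes> (y \<oplus> b \<otimes> x)"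
      by (auto simp: f_def point_def)
    then have "a \<otimes> x \<oplus> \<one> \<otimes> y = (d \<otimes> b) \<otimes> x \<oplus> d \<otimes> y"
      using ab c by (simp add: r_distr m_assoc a_comm)
    from indep_eqD[OF g(3) c _ _ _ _ this] ab d have "a = d \<otimes> b" "d = \<one>" by simp_all
    then show "a = b" using ab by simp
  qed
  moreover have "point x \<notin> f ` k"
  proof
    assume "point x \<in> f ` k"
    then obtain b where b: "b \<in> k" "x \<in> f b" using point_self[OF c(1)] by auto
    then obtain d where d: "d \<in> k" "x = d \<otimes> (y \<oplus> b \<otimes> x)"
      by (auto simp: f_def point_def)
    then have "\<one> \<otimes> x \<oplus> \<zero> \<otimes> y = (d \<otimes> b) \<otimes> x \<oplus> d \<otimes> y"
      using b c by (simp add: r_distr m_assoc a_comm)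
    from indep_eqD[OF g(3) c _ _ _ _ this] b d have "\<one> = d \<otimes> b" "d = \<zero>" by simp_all
    then show False using b by simp
  qed
  ultimately show ?thesis
    using finite_k by (simp add: card_image card_k)
qed

text \<open>Each new vector is found by counting: a point has at most \<open>q\<close> and a span of
  two vectors at most \<open>q ^ 2\<close> of the \<open>q ^ 3\<close> elements.\<close>

lemma basis_exists:
  obtains e1 e2 e3 where "e1 \<in> carrier R" "e2 \<in> carrier R" "e3 \<in> carrier R"
    "indep e1 e2" "e3 \<notin> span2 e1 e2"
proof -
  have q: "1 < q" "q < q ^ 3" "q ^ 2 < q ^ 3"
    using q_ge_2 power_strict_increasing[of 1 3 q] power_strict_increasing[of 2 3 q] by auto
  obtain e2 where e2: "e2 \<in> carrier R" "e2 \<noteq> \<zero>" by (metis one_closed one_not_zero)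
  have "\<not> carrier R \<subseteq> point e2"
    using card_mono[OF finite_subset[OF point_carrier[OF e2(1)] finite_carrier], of "carrier R"]
      card_point_le[of e2] q card_carrier by auto
  then obtain e1 where e1: "e1 \<in> carrier R" "e1 \<notin> point e2" by blast
  have "\<not> carrier R \<subseteq> span2 e1 e2"
    using card_mono[OF finite_subsp[OF subsp_span2[OF e1(1) e2(1)]], of "carrier R"]
      card_span2_le[of e1 e2] q card_carrier by auto
  then obtain e3 where "e3 \<in> carrier R" "e3 \<notin> span2 e1 e2" by blast
  then show ?thesis using that e1 e2 indepI by blast
qed

text \<open>Equal points would put all three vectors into the span of \<open>v\<close> and
  \<open>w\<close>. This reduces distinctness of points to the absence of a small subspace
  containing three given vectors.\<close>

lemma point_neI:
  assumes "\<And>A. \<lbrakk>subsp A; card A \<le> q ^ 2\<rbrakk> \<Longrightarrow> \<not> (u \<in> A \<and> v \<in> A \<and> w \<in> A)"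
    and c: "u \<in> carrier R" "v \<in> carrier R" "w \<in> carrier R"
  shows "point u \<noteq> point v"
proof
  assume "point u = point v"
  then have "u \<in> point v" using point_self[OF c(1)] by simp
  then have "u \<in> span2 v w" using point_subset[OF subsp_span2[OF c(2,3)] span2_gens(1)[OF c(2,3)]] by blast
  then show False
    using assms(1)[OF subsp_span2[OF c(2,3)] card_span2_le] span2_gens[OF c(2,3)] by blast
qed

lemma quadrangle_exists:
  "\<exists>Q. Q \<subseteq> Points \<and> card Q = 4 \<and> (\<forall>l\<in>Lines. card (l \<inter> Q) \<le> 2)"
proof -
  obtain e1 e2 e3 where e: "e1 \<in> carrier R" "e2 \<in> carrier R" "e3 \<in> carrier R"
    "indep e1 e2" "e3 \<notin> span2 e1 e2"
    by (rule basis_exists)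
  \<comment> \<open>With the sum of a basis as fourth vector, any three of the four recover the
    remaining one by subtraction, so no three lie in a subspace with at most \<open>q ^ 2\<close>
    elements.\<close>
  define e4 where "e4 = e1 \<oplus> e2 \<oplus> e3"
  have e4: "e4 \<in> carrier R" using e by (simp add: e4_def)
  have k1: "\<not> (e1 \<in> A \<and> e2 \<in> A \<and> e3 \<in> A)" if "subsp A" "card A \<le> q ^ 2" for A
    using subsp_eq_span2[OF that _ _ e(4)] e(5) by blast
  have diffs: "e3 = e4 \<ominus> e1 \<ominus> e2" "e2 = e4 \<ominus> e1 \<ominus> e3" "e1 = e4 \<ominus> e2 \<ominus> e3"
    unfolding e4_def using e(1-3) by algebra+
  have k2: "\<not> (e1 \<in> A \<and> e2 \<in> A \<and> e4 \<in> A)" if "subsp A" "card A \<le> q ^ 2" for A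
    using k1[OF that] subsp_diff[OF that(1)] diffs(1) by metis
  have k3: "\<not> (e1 \<in> A \<and> e3 \<in> A \<and> e4 \<in> A)" if "subsp A" "card A \<le> q ^ 2" for A
    using k1[OF that] subsp_diff[OF that(1)] diffs(2) by metis
  have k4: "\<not> (e2 \<in> A \<and> e3 \<in> A \<and> e4 \<in> A)" if "subsp A" "card A \<le> q ^ 2" for A
    using k1[OF that] subsp_diff[OF that(1)] diffs(3) by metis
  have ne: "point e1 \<noteq> point e2" "point e1 \<noteq> point e3" "point e1 \<noteq> point e4" "point e2 \<noteq> point e3" "point e2 \<noteq> point e4" "point e3 \<noteq> point e4"
    using point_neI[of e1 e2 e3] point_neI[of e1 e3 e2] point_neI[of e1 e4 e2] point_neI[of e2 e3 e1]
      point_neI[of e2 e4 e1] point_neI[of e3 e4 e1] k1 k2 k3 e e4 by blast+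
  have nz: "e1 \<noteq> \<zero>" "e2 \<noteq> \<zero>" "e3 \<noteq> \<zero>" "e4 \<noteq> \<zero>"
  proof -
    show "e1 \<noteq> \<zero>" "e2 \<noteq> \<zero>" using indep_nz[OF e(4,1,2)] .
    have s: "subsp (span2 e1 e2)" by (rule subsp_span2[OF e(1,2)])
    show "e3 \<noteq> \<zero>" using subspD(3)[OF s] e(5) by blast
    show "e4 \<noteq> \<zero>" using subspD(3)[OF s] k2[OF s card_span2_le] span2_gens[OF e(1,2)] by blast
  qed
  define Q where "Q = {point e1, point e2, point e3, point e4}"
  have "Q \<subseteq> Points" using point_in_Points e e4 nz by (simp add: Q_def)
  moreover have "card Q = 4" using ne by (simp add: Q_def)
  moreover have "card (l \<inter> Q) \<le> 2" if l: "l \<in> Lines" for l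
  proof -
    obtain A where A: "subsp A" "card A = q ^ 2" "l = points_in A" using l by (auto simp: Lines_def)
    have m: "point e1 \<in> l \<longleftrightarrow> e1 \<in> A" "point e2 \<in> l \<longleftrightarrow> e2 \<in> A" "point e3 \<in> l \<longleftrightarrow> e3 \<in> A" "point e4 \<in> l \<longleftrightarrow> e4 \<in> A"
      using point_in_points_in[OF A(1)] e e4 nz A(3) by auto
    have "\<exists>u v. l \<inter> Q \<subseteq> {u, v}"
      using k1[OF A(1)] k2[OF A(1)] k3[OF A(1)] k4[OF A(1)] A(2) m
      unfolding Q_def by auto
    then obtain u v where "l \<inter> Q \<subseteq> {u, v}" by blast
    then have "card (l \<inter> Q) \<le> card {u, v}" by (intro card_mono) auto
    also have "\<dots> \<le> 2" by (simp add: card_insert_if)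
    finally show ?thesis .
  qed
  ultimately show ?thesis by blast
qed

lemma finite_Points: "finite Points"
  using finite_carrier by (simp add: Points_def)

lemma projective_plane_Points: "projective_plane_of_order q Points Lines"
  unfolding projective_plane_of_order_def projective_plane_def
  using unique_line unique_point quadrangle_exists finite_Points card_line
  by (auto simp: Lines_def points_in_def)

section \<open>Inversion\<close>

text \<open>Sending zero to zero makes this an involution of the whole field that maps points to
  points, their zero included.\<close>

definition recip :: "'a \<Rightarrow> 'a" where
  "recip x = (if x = \<zero> then \<zero> else inv x)"

lemma recip_involution: "x \<in> carrier R \<Longrightarrow> recip (recip x) = x"
  by (simp add: recip_def)

text \<open>Inversion is multiplicative, and on the scalars it permutes \<open>k\<close>.\<close>

lemma recip_point:
  assumes x: "x \<in> carrier R" "x \<noteq> \<zero>"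
  shows "recip ` point x = point (inv x)"
proof -
  have recip: "recip (a \<otimes> x) = recip a \<otimes> inv x" if "a \<in> k" for a
    using that x integral[of a x] by (auto simp: recip_def nz_inv_mult)
  have k: "recip a \<in> k" "recip (recip a) = a" if "a \<in> k" for a
    using that recip_involution[of a] by (auto simp: recip_def)
  have "a \<otimes> inv x \<in> recip ` point x" if "a \<in> k" for a
  proof -
    have "a \<otimes> inv x = recip (recip a \<otimes> x)" using recip[of "recip a"] k that by simp
    then show ?thesis using k that by (auto simp: point_def)
  qed
  then show ?thesis using recip k by (auto simp: point_def)
qed

lemma bij_recip_Points: "bij_betw (image recip) Points Points"
proof (rule bij_betw_byWitness[where f' = "image recip"])
  have "recip ` recip ` p = p" if p: "p \<in> Points" for p
  proof -
    obtain x where x: "x \<in> carrier R" "x \<noteq> \<zero>" "p = point x" using p by (rule PtsE)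
    show ?thesis unfolding x(3) recip_point[OF x(1,2)] using x by (subst recip_point) auto
  qed
  \<comment> \<open>The map is its own inverse, so the two inverse conditions coincide, and likewise
    the two image conditions.\<close>
  then show "\<forall>p\<in>Points. recip ` recip ` p = p" "\<forall>p\<in>Points. recip ` recip ` p = p" by blast+
  show "image recip ` Points \<subseteq> Points" "image recip ` Points \<subseteq> Points"
    by (auto elim!: PtsE simp: recip_point point_in_Points)
qed

section \<open>Intersections of lines with inverted lines\<close>

text \<open>The relation among the three vectors and the one among their inverses combine to a
  quadratic equation over \<open>k\<close> for a ratio \<open>t\<close> outside \<open>k\<close>.
  Its coefficients \<open>e\<close>, \<open>d \<oplus> e \<ominus> \<one>\<close> and
  \<open>d\<close> cannot all vanish.\<close>

lemma no_three_common:
  assumes A: "subsp A" "card A = q ^ 2" and B: "subsp B" "card B = q ^ 2"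
    and x: "x \<in> A" "x \<noteq> \<zero>" "inv x \<in> B" and y: "y \<in> A" "y \<noteq> \<zero>" "inv y \<in> B"
    and z: "z \<in> A" "z \<noteq> \<zero>" "inv z \<in> B"
    and ne: "point x \<noteq> point y" "point x \<noteq> point z" "point y \<noteq> point z"
  shows False
proof -
  have c: "x \<in> carrier R" "y \<in> carrier R" "z \<in> carrier R" using subspD(2)[OF A(1)] x y z by auto
  have "indep x y" using indep_points_in c x y ne by blast
  then have "z \<in> span2 x y" using subsp_eq_span2[OF A(1) _ x(1) y(1)] A(2) z by simp
  then obtain a b where ab: "z = a \<otimes> x \<oplus> b \<otimes> y" "a \<in> k" "b \<in> k" by (auto simp: span2_def)
  have "a \<noteq> \<zero>"
  proof
    assume "a = \<zero>"
    then have "z \<in> point y" using ab c by (auto simp: point_def)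
    then show False using point_eqI[OF _ z(2) c(2)] ne by simp
  qed
  have "b \<noteq> \<zero>"
  proof
    assume "b = \<zero>"
    then have "z \<in> point x" using ab c by (auto simp: point_def)
    then show False using point_eqI[OF _ z(2) c(1)] ne by simp
  qed
  \<comment> \<open>Rescaling by elements of \<open>k\<close> keeps the points and gives
    \<open>z = u \<oplus> v\<close>.\<close>
  define u where "u = a \<otimes> x"
  define v where "v = b \<otimes> y"
  have uv: "u \<in> carrier R" "v \<in> carrier R" "u \<noteq> \<zero>" "v \<noteq> \<zero>"
    using ab c x y \<open>a \<noteq> \<zero>\<close> \<open>b \<noteq> \<zero>\<close> integral[of a x] integral[of b y] by (auto simp: u_def v_def)
  have ptu: "point u = point x" using ab uv by (intro point_eqI c) (auto simp: u_def point_def)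
  have ptv: "point v = point y" using ab uv by (intro point_eqI c) (auto simp: v_def point_def)
  have iB: "inv u \<in> B" "inv v \<in> B"
    using ab c x y \<open>a \<noteq> \<zero>\<close> \<open>b \<noteq> \<zero>\<close> subspD(5)[OF B(1)] by (auto simp: u_def v_def nz_inv_mult)
  \<comment> \<open>Dividing by \<open>v\<close> leaves one unknown: \<open>u\<close> and
    \<open>z\<close> are \<open>t\<close> and \<open>t \<oplus> \<one>\<close> times
    \<open>v\<close>.\<close>
  define t where "t = u \<otimes> inv v"
  have t: "t \<in> carrier R" "t \<noteq> \<zero>" using uv integral[of u "inv v"] by (auto simp: t_def)
  have utv: "u = t \<otimes> v" using uv by (simp add: t_def m_assoc)
  have tk: "t \<notin> k"
  proof
    assume "t \<in> k"
    then have "u \<in> point v" using utv by (auto simp: point_def)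
    then show False using point_eqI[OF _ uv(3) uv(2)] ptu ptv ne by simp
  qed
  \<comment> \<open>Proportional inverses would make \<open>u\<close> and \<open>v\<close>
    proportional.\<close>
  have "indep (inv u) (inv v)"
  proof (rule indepI)
    show "inv u \<notin> point (inv v)"
    proof
      assume "inv u \<in> point (inv v)"
      then obtain d where d: "d \<in> k" "inv u = d \<otimes> inv v" by (auto simp: point_def)
      then have "d \<noteq> \<zero>" using uv nz_inv(2)[of u] by auto
      have "u = inv d \<otimes> v"
        using arg_cong[OF d(2), of "\<lambda>x. inv x"] d(1) \<open>d \<noteq> \<zero>\<close> uv by (simp add: nz_inv_mult)
      then have "u \<in> point v" using d \<open>d \<noteq> \<zero>\<close> by (auto simp: point_def)
      then show False using point_eqI[OF _ uv(3) uv(2)] ptu ptv ne by simp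
    qed
  qed (use uv in auto)
  then have "inv z \<in> span2 (inv u) (inv v)" using subsp_eq_span2[OF B(1) _ iB] B(2) z by simp
  then obtain d e where de: "inv z = d \<otimes> inv u \<oplus> e \<otimes> inv v" "d \<in> k" "e \<in> k" by (auto simp: span2_def)
  have zuv: "z = (t \<oplus> \<one>) \<otimes> v" using ab(1) utv uv t by (simp add: u_def v_def l_distr)
  have dk: "d \<in> carrier R" "e \<in> carrier R" using de by auto
  have iu: "inv u = inv t \<otimes> inv v" unfolding utv using uv t by (simp add: nz_inv_mult)
  \<comment> \<open>Writing one as \<open>inv z \<otimes> z\<close> and inserting the expressions
    for both factors, \<open>v\<close> cancels against \<open>inv v\<close>, and the factor
    \<open>t\<close> clears the denominator \<open>inv t\<close>.\<close>
  have "t = t \<otimes> (inv z \<otimes> z)" using t c z by simp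
  also have "\<dots> = t \<otimes> ((d \<otimes> (inv t \<otimes> inv v) \<oplus> e \<otimes> inv v) \<otimes> ((t \<oplus> \<one>) \<otimes> v))"
    unfolding de(1) iu using zuv by simp
  also have "\<dots> = (d \<otimes> (t \<otimes> inv t) \<oplus> e \<otimes> t) \<otimes> (t \<oplus> \<one>) \<otimes> (inv v \<otimes> v)"
    using dk t(1) uv(2) nz_inv(1)[OF t] nz_inv(1)[OF uv(2,4)] by algebra
  also have "\<dots> = (d \<oplus> e \<otimes> t) \<otimes> (t \<oplus> \<one>)" using t uv dk by simp
  finally have eq: "t = (d \<oplus> e \<otimes> t) \<otimes> (t \<oplus> \<one>)" .
  have "e \<otimes> (t \<otimes> t) \<oplus> (d \<oplus> e \<ominus> \<one>) \<otimes> t \<oplus> d = (d \<oplus> e \<otimes> t) \<otimes> (t \<oplus> \<one>) \<ominus> t"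
    using dk t(1) by (simp add: a_minus_def l_distr r_distr l_minus r_minus a_ac m_ac)
  also have "\<dots> = \<zero>" unfolding eq[symmetric] using t by simp
  finally have root: "e \<otimes> (t \<otimes> t) \<oplus> (d \<oplus> e \<ominus> \<one>) \<otimes> t \<oplus> d = \<zero>" .
  have "e = \<zero>" "d \<oplus> e \<ominus> \<one> = \<zero>" "d = \<zero>"
    using quadratic_over_k_trivial[OF t(1) tk _ _ _ root] de by simp_all
  then show False by (simp add: a_minus_def)
qed

lemma orthogoval_lines:
  assumes "l \<in> Lines" "m \<in> Lines"
  shows "card (l \<inter> image recip ` m) \<le> 2"
proof (rule ccontr)
  assume "\<not> ?thesis"
  then obtain T where T: "T \<subseteq> l \<inter> image recip ` m" "card T = 3"
    using obtain_subset_with_card_n[of 3 "l \<inter> image recip ` m"] by force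
  then obtain p1 p2 p3 where p: "T = {p1, p2, p3}" "p1 \<noteq> p2" "p1 \<noteq> p3" "p2 \<noteq> p3"
    by (auto simp: card_3_iff)
  obtain A where A: "subsp A" "card A = q ^ 2" "l = points_in A" using assms by (auto simp: Lines_def)
  obtain B where B: "subsp B" "card B = q ^ 2" "m = points_in B" using assms by (auto simp: Lines_def)
  have rep: "\<exists>x. p = point x \<and> x \<in> A \<and> x \<noteq> \<zero> \<and> inv x \<in> B" if "p \<in> T" for p
  proof -
    have "p \<in> l" "p \<in> image recip ` m" using that T by auto
    then obtain x where x: "x \<in> carrier R" "x \<noteq> \<zero>" "p = point x"
      using A(3) by (auto simp: points_in_def elim: PtsE)
    obtain p' where p': "p' \<in> m" "p = recip ` p'" using \<open>p \<in> image recip ` m\<close> by blast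
    obtain y where y: "y \<in> carrier R" "y \<noteq> \<zero>" "p' = point y"
      using p' B(3) by (auto simp: points_in_def elim: PtsE)
    \<comment> \<open>Inversion is an involution on points, so a point of the inverted line is
      carried back to a point of \<open>m\<close>; its representative then has its inverse in
      \<open>B\<close>.\<close>
    have "recip ` p = p'" using p' y by (simp add: recip_point)
    then have "point (inv x) \<in> m" using x recip_point p' by simp
    then show ?thesis
      using x \<open>p \<in> l\<close> point_in_points_in[OF A(1), of x] point_in_points_in[OF B(1), of "inv x"] A(3) B(3) by auto
  qed
  obtain x y z where "p1 = point x \<and> x \<in> A \<and> x \<noteq> \<zero> \<and> inv x \<in> B"
    "p2 = point y \<and> y \<in> A \<and> y \<noteq> \<zero> \<and> inv y \<in> B" "p3 = point z \<and> z \<in> A \<and> z \<noteq> \<zero> \<and> inv z \<in> B"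
    using rep p(1) by (metis insertI1 insertI2)
  then show False using no_three_common[OF A(1,2) B(1,2)] p by blast
qed

end

section \<open>Isomorphic planes and coordinates\<close>

lemma projective_plane_of_order_image:
  assumes pp: "projective_plane_of_order n P L" and inj: "inj_on f P"
  shows "projective_plane_of_order n (f ` P) (image f ` L)"
proof -
  have sub: "l \<subseteq> P" if "l \<in> L" for l
    using pp that by (auto simp: projective_plane_of_order_def projective_plane_def)
  \<comment> \<open>\<open>f\<close> is injective only on \<open>P\<close>; since lines lie in
    \<open>P\<close>, membership is still reflected.\<close>
  have mem: "f x \<in> f ` l \<longleftrightarrow> x \<in> l" if "x \<in> P" "l \<in> L" for x l
    using inj_on_image_mem_iff[OF inj that(1) sub[OF that(2)]] .
  have lines: "\<exists>!l. l \<in> L \<and> x \<in> l \<and> y \<in> l" if "x \<in> P" "y \<in> P" "x \<noteq> y" for x y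
    using pp that by (auto simp: projective_plane_of_order_def projective_plane_def)
  have points: "\<exists>!x. x \<in> l \<and> x \<in> m" if "l \<in> L" "m \<in> L" "l \<noteq> m" for l m
    using pp that by (auto simp: projective_plane_of_order_def projective_plane_def)
  obtain Q where Q: "Q \<subseteq> P" "card Q = 4" "\<And>l. l \<in> L \<Longrightarrow> card (l \<inter> Q) \<le> 2"
    using pp by (auto simp: projective_plane_of_order_def projective_plane_def)
  have fin: "finite P" and card: "card l = n + 1" if "l \<in> L" for l
    using pp that by (auto simp: projective_plane_of_order_def)
  show ?thesis
    unfolding projective_plane_of_order_def projective_plane_def
  proof (intro conjI ballI impI)
    fix l assume "l \<in> image f ` L"
    then obtain l0 where l: "l0 \<in> L" "l = f ` l0" by blast
    then show "l \<subseteq> f ` P" using sub by blast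
    show "card l = n + 1"
      unfolding l(2) using card_image[OF inj_on_subset[OF inj sub[OF l(1)]]] card[OF l(1)] by simp
  next
    fix x y assume "x \<in> f ` P" "y \<in> f ` P" "x \<noteq> y"
    then obtain a b where ab: "a \<in> P" "b \<in> P" "a \<noteq> b" "x = f a" "y = f b" by blast
    obtain l where l: "l \<in> L" "a \<in> l" "b \<in> l" "\<And>m. m \<in> L \<and> a \<in> m \<and> b \<in> m \<Longrightarrow> m = l"
      using lines[OF ab(1-3)] by blast
    show "\<exists>!l. l \<in> image f ` L \<and> x \<in> l \<and> y \<in> l"
    proof (rule ex1I[of _ "f ` l"])
      show "f ` l \<in> image f ` L \<and> x \<in> f ` l \<and> y \<in> f ` l" using l ab by blast
      fix m assume m: "m \<in> image f ` L \<and> x \<in> m \<and> y \<in> m"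
      then obtain m0 where m0: "m0 \<in> L" "m = f ` m0" by blast
      have "a \<in> m0" "b \<in> m0"
        using m unfolding ab(4,5) m0(2) mem[OF ab(1) m0(1)] mem[OF ab(2) m0(1)] by auto
      then have "m0 = l" using l(4) m0(1) by simp
      then show "m = f ` l" using m0 by simp
    qed
  next
    fix l' m' assume "l' \<in> image f ` L" "m' \<in> image f ` L" "l' \<noteq> m'"
    then obtain l m where lm: "l \<in> L" "m \<in> L" "l \<noteq> m" "l' = f ` l" "m' = f ` m" by blast
    obtain a where a: "a \<in> l" "a \<in> m" "\<And>b. b \<in> l \<and> b \<in> m \<Longrightarrow> b = a"
      using points[OF lm(1-3)] by blast
    show "\<exists>!x. x \<in> l' \<and> x \<in> m'"
    proof (rule ex1I[of _ "f a"])
      show "f a \<in> l' \<and> f a \<in> m'" using a lm by blast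
      fix y assume "y \<in> l' \<and> y \<in> m'"
      then obtain b where b: "b \<in> l" "y = f b" "f b \<in> f ` m" using lm by blast
      then have "b \<in> m" using mem sub lm by blast
      then show "y = f a" using a(3) b by blast
    qed
  next
    have "card (f ` l \<inter> f ` Q) \<le> 2" if "l \<in> L" for l
    proof -
      have "f ` l \<inter> f ` Q = f ` (l \<inter> Q)"
        using inj_on_image_Int[OF inj sub[OF that] Q(1)] by simp
      \<comment> \<open>An infinite set has cardinality 0, so \<open>card Q = 4\<close> forces
        \<open>Q\<close> to be finite.\<close>
      moreover have "finite (l \<inter> Q)" using Q(1,2) by (metis card.infinite finite_Int zero_neq_numeral)
      ultimately show ?thesis using card_image_le[of "l \<inter> Q" f] Q(3)[OF that] by simp
    qed
    then show "\<exists>Q\<subseteq>f ` P. card Q = 4 \<and> (\<forall>l\<in>image f ` L. card (l \<inter> Q) \<le> 2)"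
      using Q card_image[OF inj_on_subset[OF inj Q(1)]]
      by (intro exI[of _ "f ` Q"]) (simp add: image_mono)
  next
    show "finite (f ` P)" using pp by (simp add: projective_plane_of_order_def)
  qed
qed

text \<open>The inverse of \<open>f\<close> on \<open>P\<close> undoes \<open>f\<close> only on
  subsets of \<open>P\<close>, hence the condition that the lines lie in \<open>P\<close>.\<close>

lemma plane_isomorphic_sym:
  assumes "plane_isomorphic P L P' L'" and sub: "\<And>l. l \<in> L \<Longrightarrow> l \<subseteq> P"
  shows "plane_isomorphic P' L' P L"
proof -
  obtain f where f: "bij_betw f P P'" "image f ` L = L'"
    using assms(1) by (auto simp: plane_isomorphic_def)
  have "inv_into P f ` f ` l = l" if "l \<in> L" for l
    using inv_into_image_cancel[OF bij_betw_imp_inj_on[OF f(1)] sub[OF that]] .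
  then have "image (inv_into P f) ` L' = L"
    unfolding f(2)[symmetric] image_image[of "image (inv_into P f)"] by simp
  then show ?thesis
    unfolding plane_isomorphic_def using bij_betw_inv_into[OF f(1)] by blast
qed

lemma plane_isomorphic_trans:
  assumes "plane_isomorphic P L P' L'" "plane_isomorphic P' L' P'' L''"
  shows "plane_isomorphic P L P'' L''"
proof -
  obtain f g where f: "bij_betw f P P'" "image f ` L = L'"
    and g: "bij_betw g P' P''" "image g ` L' = L''"
    using assms by (auto simp: plane_isomorphic_def)
  have "image (g \<circ> f) ` L = L''"
    unfolding g(2)[symmetric] f(2)[symmetric] image_image[of "image g"] image_comp[symmetric] ..
  then show ?thesis
    unfolding plane_isomorphic_def using bij_betw_trans[OF f(1) g(1)] by blast
qed

text \<open>The coordinate field is unchanged: going back along \<open>f\<close> and on to PG(2,q)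
  is an isomorphism. Serves both for the inversion and for numbering the points.\<close>

lemma desarguesian_plane_of_order_image:
  assumes d: "desarguesian_plane_of_order q P L" and inj: "inj_on f P"
  shows "desarguesian_plane_of_order q (f ` P) (image f ` L)"
proof -
  have "plane_isomorphic P L (f ` P) (image f ` L)"
    unfolding plane_isomorphic_def using inj_on_imp_bij_betw[OF inj] by blast
  moreover have "l \<subseteq> P" if "l \<in> L" for l
    using d that
    by (auto simp: desarguesian_plane_of_order_def projective_plane_of_order_def projective_plane_def)
  ultimately have "plane_isomorphic (f ` P) (image f ` L) P L"
    by (rule plane_isomorphic_sym)
  then show ?thesis
    using d projective_plane_of_order_image[OF _ inj] plane_isomorphic_trans
    unfolding desarguesian_plane_of_order_def by blast
qed

section \<open>Coordinates and the isomorphism with PG(2,q)\<close>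

context cubic_extension
begin

text \<open>Brings the lines into the shape of \<open>PG2_lines\<close>, parametrized by independent
  pairs.\<close>

lemma Lines_span2: "Lines = {points_in (span2 x y) | x y. x \<in> carrier R \<and> y \<in> carrier R \<and> indep x y}"
proof
  show "Lines \<subseteq> {points_in (span2 x y) | x y. x \<in> carrier R \<and> y \<in> carrier R \<and> indep x y}"
  proof
    fix l assume "l \<in> Lines"
    then obtain A where A: "subsp A" "card A = q ^ 2" "l = points_in A" by (auto simp: Lines_def)
    obtain x y where "x \<in> A" "y \<in> A" "indep x y" "A = span2 x y" using subsp_gens[OF A(1,2)] .
    then show "l \<in> {points_in (span2 x y) | x y. x \<in> carrier R \<and> y \<in> carrier R \<and> indep x y}"
      using A(3) subspD(2)[OF A(1)] by blast
  qed
qed (use subsp_span2 card_span2 in \<open>auto simp: Lines_def\<close>)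

text \<open>The map \<open>g\<close> lets the coordinates come from another field than
  \<open>k\<close> itself, such as a copy of \<open>k\<close> on the natural numbers.\<close>

definition coord :: "'a \<Rightarrow> 'a \<Rightarrow> 'a \<Rightarrow> ('c \<Rightarrow> 'a) \<Rightarrow> 'c \<times> 'c \<times> 'c \<Rightarrow> 'a" where
  "coord e1 e2 e3 g = (\<lambda>(a, b, c). g a \<otimes> e1 \<oplus> g b \<otimes> e2 \<oplus> g c \<otimes> e3)"

text \<open>Injectivity comes from independence; surjectivity follows because both sides have
  \<open>q ^ 3\<close> elements.\<close>

lemma coord_bij:
  assumes e: "e1 \<in> carrier R" "e2 \<in> carrier R" "e3 \<in> carrier R" "indep e1 e2" "e3 \<notin> span2 e1 e2"
    and g: "bij_betw g F k"
  shows "bij_betw (coord e1 e2 e3 g) (F \<times> F \<times> F) (carrier R)"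
proof -
  have gk: "a \<in> F \<Longrightarrow> g a \<in> k" for a using bij_betwE[OF g] by blast
  have gi: "\<lbrakk>g a = g b; a \<in> F; b \<in> F\<rbrakk> \<Longrightarrow> a = b" for a b
    using inj_onD[OF bij_betw_imp_inj_on[OF g]] by blast
  have inj: "inj_on (coord e1 e2 e3 g) (F \<times> F \<times> F)"
  proof (rule inj_onI)
    fix u v
    assume uv: "u \<in> F \<times> F \<times> F" "v \<in> F \<times> F \<times> F"
      and "coord e1 e2 e3 g u = coord e1 e2 e3 g v"
    moreover obtain a b c where u: "u = (a, b, c)" by (cases u)
    moreover obtain a' b' c' where v: "v = (a', b', c')" by (cases v)
    ultimately have eq: "coord e1 e2 e3 g (a, b, c) = coord e1 e2 e3 g (a', b', c')" by simp
    have el: "a \<in> F" "b \<in> F" "c \<in> F" "a' \<in> F" "b' \<in> F" "c' \<in> F"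
      using uv u v by auto
    have s: "subsp (span2 e1 e2)" by (rule subsp_span2[OF e(1,2)])
    have kc: "g a \<in> carrier R" "g b \<in> carrier R" "g c \<in> carrier R" "g a' \<in> carrier R" "g b' \<in> carrier R" "g c' \<in> carrier R"
      using gk el by auto
    \<comment> \<open>Equal values put a multiple of \<open>e3\<close> into the span of
      \<open>e1\<close> and \<open>e2\<close>; a nonzero multiple would put \<open>e3\<close> itself
      there.\<close>
    have "(g c \<ominus> g c') \<otimes> e3 =
      (g a \<otimes> e1 \<oplus> g b \<otimes> e2 \<oplus> g c \<otimes> e3) \<ominus> (g a \<otimes> e1 \<oplus> g b \<otimes> e2 \<oplus> g c' \<otimes> e3)"
      using kc e(1-3) by algebra
    also have "\<dots> = (g a' \<otimes> e1 \<oplus> g b' \<otimes> e2 \<oplus> g c' \<otimes> e3) \<ominus> (g a \<otimes> e1 \<oplus> g b \<otimes> e2 \<oplus> g c' \<otimes> e3)"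
      using eq by (simp add: coord_def)
    also have "\<dots> = (g a' \<otimes> e1 \<oplus> g b' \<otimes> e2) \<ominus> (g a \<otimes> e1 \<oplus> g b \<otimes> e2)"
      using kc e(1-3) by algebra
    also have "\<dots> \<in> span2 e1 e2"
      using el by (intro subsp_diff[OF s] sp2I gk)
    finally have m: "(g c \<ominus> g c') \<otimes> e3 \<in> span2 e1 e2" .
    have cc: "g c = g c'"
    proof (rule ccontr)
      assume "g c \<noteq> g c'"
      then have nz: "g c \<ominus> g c' \<noteq> \<zero>" using kc by simp
      have dk: "g c \<ominus> g c' \<in> k" using gk el by simp
      have "inv (g c \<ominus> g c') \<otimes> ((g c \<ominus> g c') \<otimes> e3) \<in> span2 e1 e2"
        using subspD(5)[OF s k_inv[OF dk nz] m] .
      then show False using nz_inv_cancel(1)[OF k_carrier[OF dk] nz e(3)] e(5) by simp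
    qed
    have "g a \<otimes> e1 \<oplus> g b \<otimes> e2 \<oplus> g c' \<otimes> e3 = g a' \<otimes> e1 \<oplus> g b' \<otimes> e2 \<oplus> g c' \<otimes> e3"
      using eq cc by (simp add: coord_def)
    then have "g a \<otimes> e1 \<oplus> g b \<otimes> e2 = g a' \<otimes> e1 \<oplus> g b' \<otimes> e2"
      using kc e(1-3) by simp
    from indep_eqD[OF e(4,1,2) _ _ _ _ this] gk el have "g a = g a'" "g b = g b'" by simp_all
    then show "u = v" using cc gi el u v by blast
  qed
  have img: "coord e1 e2 e3 g ` (F \<times> F \<times> F) \<subseteq> carrier R"
    using gk e by (auto simp: coord_def)
  have "card F = q" using bij_betw_same_card[OF g] card_k by simp
  then have "card (coord e1 e2 e3 g ` (F \<times> F \<times> F)) = card (carrier R)"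
    by (simp add: card_image[OF inj] card_cartesian_product card_carrier power3_eq_cube)
  then have "coord e1 e2 e3 g ` (F \<times> F \<times> F) = carrier R"
    by (rule card_subset_eq[OF finite_carrier img])
  then show ?thesis using inj by (simp add: bij_betw_def)
qed

text \<open>A basis gives a bijection \<open>\<theta>\<close> from triples over \<open>F\<close> to
  \<open>R\<close> that is linear along \<open>g\<close>, so it matches spans with spans and
  independent pairs with independent pairs.\<close>

lemma plane_isomorphic_PG2:
  assumes F: "field F" and g: "g \<in> ring_iso F (R\<lparr>carrier := k\<rparr>)"
  shows "plane_isomorphic Points Lines (PG2_points F) (PG2_lines F)"
proof -
  interpret F: field F by (rule F)
  obtain e1 e2 e3 where e: "e1 \<in> carrier R" "e2 \<in> carrier R" "e3 \<in> carrier R"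
    "indep e1 e2" "e3 \<notin> span2 e1 e2"
    by (rule basis_exists)
  define \<theta> where "\<theta> = coord e1 e2 e3 g"
  have gb: "bij_betw g (carrier F) k" using ring_iso_memE(5)[OF g] by simp
  have gk: "a \<in> carrier F \<Longrightarrow> g a \<in> k" for a using bij_betwE[OF gb] by blast
  have gim: "g ` carrier F = k" using bij_betw_imp_surj_on[OF gb] .
  have gh: "g (a \<otimes>\<^bsub>F\<^esub> b) = g a \<otimes> g b" "g (a \<oplus>\<^bsub>F\<^esub> b) = g a \<oplus> g b" if "a \<in> carrier F" "b \<in> carrier F" for a b
    using ring_iso_memE(2,3)[OF g that] by simp_all
  have g0: "g \<zero>\<^bsub>F\<^esub> = \<zero>"
  proof -
    have "g \<zero>\<^bsub>F\<^esub> \<oplus> g \<zero>\<^bsub>F\<^esub> = g \<zero>\<^bsub>F\<^esub>" using gh(2)[of "\<zero>\<^bsub>F\<^esub>" "\<zero>\<^bsub>F\<^esub>"] by simp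
    then show ?thesis using k_carrier[OF gk[OF F.zero_closed]] by (metis add.l_cancel_one)
  qed
  have \<theta>b: "bij_betw \<theta> (vec3_carrier F) (carrier R)"
    unfolding \<theta>_def vec3_carrier_def by (rule coord_bij[OF e gb])
  have \<theta>i: "inj_on \<theta> (vec3_carrier F)" and \<theta>s: "\<theta> ` vec3_carrier F = carrier R"
    using \<theta>b by (auto simp: bij_betw_def)
  have \<theta>c: "u \<in> vec3_carrier F \<Longrightarrow> \<theta> u \<in> carrier R" for u using \<theta>s by blast
  have z: "vec3_zero F \<in> vec3_carrier F" "\<theta> (vec3_zero F) = \<zero>"
    using e by (simp_all add: vec3_zero_def vec3_carrier_def \<theta>_def coord_def g0)
  have \<theta>0: "\<theta> u = \<zero> \<longleftrightarrow> u = vec3_zero F" if "u \<in> vec3_carrier F" for u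
    using inj_onD[OF \<theta>i _ that z(1)] z(2) by auto
  have sm: "vec3_smult F a u \<in> vec3_carrier F" "\<theta> (vec3_smult F a u) = g a \<otimes> \<theta> u"
    if "a \<in> carrier F" "u \<in> vec3_carrier F" for a u
    using that e gk by (auto simp: vec3_carrier_def \<theta>_def coord_def gh r_distr m_assoc)
  have ad: "vec3_add F u v \<in> vec3_carrier F" "\<theta> (vec3_add F u v) = \<theta> u \<oplus> \<theta> v"
    if "u \<in> vec3_carrier F" "v \<in> vec3_carrier F" for u v
    using that e gk by (auto simp: vec3_carrier_def \<theta>_def coord_def gh l_distr a_ac)
  have sp1: "\<theta> ` vec3_span1 F u = point (\<theta> u)" "vec3_span1 F u \<subseteq> vec3_carrier F"
    if "u \<in> vec3_carrier F" for u
  proof -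
    have "vec3_span1 F u = (\<lambda>a. vec3_smult F a u) ` carrier F" by (auto simp: vec3_span1_def)
    then have "\<theta> ` vec3_span1 F u = (\<lambda>a. g a \<otimes> \<theta> u) ` carrier F"
      using sm(2)[OF _ that] by (simp add: image_image)
    also have "\<dots> = (\<lambda>b. b \<otimes> \<theta> u) ` g ` carrier F" by (simp add: image_image)
    finally show "\<theta> ` vec3_span1 F u = point (\<theta> u)" unfolding gim by (auto simp: point_def)
    show "vec3_span1 F u \<subseteq> vec3_carrier F" using sm(1)[OF _ that] by (auto simp: vec3_span1_def)
  qed
  have span2: "\<theta> ` vec3_span2 F u v = span2 (\<theta> u) (\<theta> v)" "vec3_span2 F u v \<subseteq> vec3_carrier F"
    if "u \<in> vec3_carrier F" "v \<in> vec3_carrier F" for u v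
  proof -
    let ?c = "\<lambda>(a, b). vec3_add F (vec3_smult F a u) (vec3_smult F b v)"
    have s: "vec3_span2 F u v = ?c ` (carrier F \<times> carrier F)" by (auto simp: vec3_span2_def)
    have "\<theta> ` vec3_span2 F u v = (\<lambda>(a, b). g a \<otimes> \<theta> u \<oplus> g b \<otimes> \<theta> v) ` (carrier F \<times> carrier F)"
      unfolding s image_image
      by (rule image_cong[OF refl]) (auto simp: ad(2) sm that)
    also have "\<dots> = (\<lambda>(a, b). a \<otimes> \<theta> u \<oplus> b \<otimes> \<theta> v) ` (map_prod g g ` (carrier F \<times> carrier F))"
      unfolding image_image by (rule image_cong[OF refl]) auto
    also have "map_prod g g ` (carrier F \<times> carrier F) = k \<times> k"
      using gim by (simp add: map_prod_surj_on)
    finally show "\<theta> ` vec3_span2 F u v = span2 (\<theta> u) (\<theta> v)" by (simp add: span2_image)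
    show "vec3_span2 F u v \<subseteq> vec3_carrier F"
      unfolding vec3_span2_def by (blast intro: ad(1) sm(1) that)
  qed
  \<comment> \<open>As \<open>g\<close> maps onto \<open>k\<close> and sends only zero to zero,
    quantifying over \<open>F\<close> amounts to quantifying over \<open>k\<close>.\<close>
  have ind: "vec3_indep2 F u v \<longleftrightarrow> indep (\<theta> u) (\<theta> v)"
    if "u \<in> vec3_carrier F" "v \<in> vec3_carrier F" for u v
  proof -
    have "vec3_add F (vec3_smult F a u) (vec3_smult F b v) = vec3_zero F \<longleftrightarrow>
      g a \<otimes> \<theta> u \<oplus> g b \<otimes> \<theta> v = \<zero>" if "a \<in> carrier F" "b \<in> carrier F" for a b
      using \<theta>0[of "vec3_add F (vec3_smult F a u) (vec3_smult F b v)"] ad sm that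
        \<open>u \<in> vec3_carrier F\<close> \<open>v \<in> vec3_carrier F\<close> by simp
    moreover have "a = \<zero>\<^bsub>F\<^esub> \<longleftrightarrow> g a = \<zero>" if "a \<in> carrier F" for a
      using inj_onD[OF bij_betw_imp_inj_on[OF gb] _ that F.zero_closed] g0 by auto
    moreover have "indep (\<theta> u) (\<theta> v) \<longleftrightarrow> (\<forall>a\<in>g ` carrier F. \<forall>b\<in>g ` carrier F.
        a \<otimes> \<theta> u \<oplus> b \<otimes> \<theta> v = \<zero> \<longrightarrow> a = \<zero> \<and> b = \<zero>)"
      by (simp add: indep_def gim)
    ultimately show ?thesis
      unfolding vec3_indep2_def by simp
  qed
  have points_in_sub: "PG2_points F \<subseteq> Pow (vec3_carrier F)"
    using sp1(2) by (auto simp: PG2_points_def)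
  have points_in: "image \<theta> ` PG2_points F = Points"
  proof -
    have "PG2_points F = vec3_span1 F ` (vec3_carrier F - {vec3_zero F})"
      by (auto simp: PG2_points_def)
    then have "image \<theta> ` PG2_points F = (\<lambda>u. point (\<theta> u)) ` (vec3_carrier F - {vec3_zero F})"
      using sp1(1) by (simp add: image_image)
    also have "\<dots> = point ` \<theta> ` (vec3_carrier F - {vec3_zero F})" by (simp add: image_image)
    also have "\<theta> ` (vec3_carrier F - {vec3_zero F}) = carrier R - {\<zero>}"
      using inj_on_image_set_diff[OF \<theta>i, of "vec3_carrier F" "{vec3_zero F}"] \<theta>s z by auto
    finally show ?thesis by (simp add: Points_def)
  qed
  have line: "image \<theta> ` {p \<in> PG2_points F. p \<subseteq> vec3_span2 F u v} = points_in (span2 (\<theta> u) (\<theta> v))"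
    if "u \<in> vec3_carrier F" "v \<in> vec3_carrier F" for u v
  proof -
    have "p \<subseteq> vec3_span2 F u v \<longleftrightarrow> \<theta> ` p \<subseteq> span2 (\<theta> u) (\<theta> v)" if p: "p \<in> PG2_points F" for p
    proof -
      have "p \<subseteq> vec3_carrier F" using p points_in_sub by blast
      then have "p \<subseteq> vec3_span2 F u v \<longleftrightarrow> \<theta> ` p \<subseteq> \<theta> ` vec3_span2 F u v"
        using inj_on_image_mem_iff[OF \<theta>i _ span2(2)[OF \<open>u \<in> vec3_carrier F\<close> \<open>v \<in> vec3_carrier F\<close>]]
        by blast
      then show ?thesis by (simp add: span2(1) \<open>u \<in> vec3_carrier F\<close> \<open>v \<in> vec3_carrier F\<close>)
    qed
    then show ?thesis unfolding points_in_def points_in[symmetric] by auto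
  qed
  have "image (image \<theta>) ` PG2_lines F = Lines"
  proof
    show "image (image \<theta>) ` PG2_lines F \<subseteq> Lines"
    proof (rule image_subsetI)
      fix l assume "l \<in> PG2_lines F"
      then obtain u v where uv: "u \<in> vec3_carrier F" "v \<in> vec3_carrier F" "vec3_indep2 F u v"
        "l = {p \<in> PG2_points F. p \<subseteq> vec3_span2 F u v}"
        unfolding PG2_lines_def by blast
      show "image \<theta> ` l \<in> Lines"
        unfolding uv(4) line[OF uv(1,2)] Lines_span2 using uv(3) ind[OF uv(1,2)] \<theta>c uv(1,2) by blast
    qed
    show "Lines \<subseteq> image (image \<theta>) ` PG2_lines F"
    proof
      fix l assume "l \<in> Lines"
      then obtain x y where xy: "x \<in> carrier R" "y \<in> carrier R" "indep x y" "l = points_in (span2 x y)"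
        by (auto simp: Lines_span2)
      then obtain u v where uv: "u \<in> vec3_carrier F" "v \<in> vec3_carrier F" "x = \<theta> u" "y = \<theta> v"
        unfolding \<theta>s[symmetric] by blast
      have "{p \<in> PG2_points F. p \<subseteq> vec3_span2 F u v} \<in> PG2_lines F"
        unfolding PG2_lines_def using uv xy(3) ind[OF uv(1,2)] by blast
      then show "l \<in> image (image \<theta>) ` PG2_lines F"
        using line[OF uv(1,2)] uv xy by blast
    qed
  qed
  moreover have "bij_betw (image \<theta>) (PG2_points F) Points"
    using inj_on_subset[OF inj_on_image_Pow[OF \<theta>i] points_in_sub] points_in by (simp add: bij_betw_def)
  ultimately have "plane_isomorphic (PG2_points F) (PG2_lines F) Points Lines"
    unfolding plane_isomorphic_def by blast
  \<comment> \<open>\<open>\<theta>\<close> leads from PG(2,q) to \<open>Points\<close>, so the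
    isomorphism is reversed.\<close>
  then show ?thesis
    by (rule plane_isomorphic_sym) (auto simp: PG2_lines_def)
qed

text \<open>The definition asks for a coordinate field on the natural numbers, so \<open>k\<close>
  is copied along an injection \<open>h\<close>.\<close>

lemma desarguesian_Points: "desarguesian_plane_of_order q Points Lines"
proof -
  obtain h :: "'a \<Rightarrow> nat" where h: "inj_on h k"
    using finite_imp_inj_to_nat_seg[OF finite_k] by blast
  let ?k = "R\<lparr>carrier := k\<rparr>"
  interpret k: field ?k by (rule subfield_iff(2)[OF subfield_k])
  define F where "F = image_ring h ?k"
  have F: "field F" unfolding F_def using h by (intro k.inj_imp_image_ring_is_field) simp
  have "h \<in> ring_iso ?k F" unfolding F_def using h by (intro inj_imp_image_ring_iso) simp
  then have "inv_into k h \<in> ring_iso F ?k"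
    using ring_iso_set_sym[OF k.ring_axioms] by fastforce
  then have "plane_isomorphic Points Lines (PG2_points F) (PG2_lines F)"
    by (rule plane_isomorphic_PG2[OF F])
  moreover have "carrier F = h ` k" by (simp add: F_def image_ring_carrier)
  ultimately show ?thesis
    unfolding desarguesian_plane_of_order_def
    using F projective_plane_Points finite_k card_image[OF h] card_k
    by (intro conjI exI[of _ F]) auto
qed

end

section \<open>The two planes on a set of natural numbers\<close>

theorem theorem2p2:
  fixes q :: nat
  assumes "primepow q"
  shows "\<exists>(P :: nat set) L L'.
           desarguesian_plane_of_order q P L \<and>
           desarguesian_plane_of_order q P L' \<and>
           orthogoval P L L'"
proof -
  obtain R :: "((int list \<times> nat) multiset \<Rightarrow> int) ring" and k where "cubic_extension R k q"
    using cubic_extension_exists[OF assms] by blast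
  then interpret cubic_extension R k q .
  \<comment> \<open>The finitely many points, which are sets, are numbered to obtain a point set of
    natural numbers.\<close>
  obtain N :: "((int list \<times> nat) multiset \<Rightarrow> int) set \<Rightarrow> nat" where N: "inj_on N Points"
    using finite_imp_inj_to_nat_seg[OF finite_Points] by blast
  \<comment> \<open>Inversion permutes \<open>Points\<close>, so the inverted lines form a plane on
    the same point set.\<close>
  have \<sigma>: "inj_on (image recip) Points" "image recip ` Points = Points"
    using bij_recip_Points by (auto simp: bij_betw_def)
  let ?L = "image N ` Lines" and ?L' = "image N ` image (image recip) ` Lines"
  have d: "desarguesian_plane_of_order q (N ` Points) ?L"
    by (rule desarguesian_plane_of_order_image[OF desarguesian_Points N])
  \<comment> \<open>Transported twice: by inversion onto \<open>Points\<close> again, then by the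
    numbering.\<close>
  have d': "desarguesian_plane_of_order q (N ` Points) ?L'"
    using desarguesian_plane_of_order_image[OF desarguesian_Points \<sigma>(1)] N
    by (intro desarguesian_plane_of_order_image) (simp_all add: \<sigma>(2))
  have "card (N ` l \<inter> N ` image recip ` m) \<le> 2" if lm: "l \<in> Lines" "m \<in> Lines" for l m
  proof -
    have sub: "l \<subseteq> Points" "image recip ` m \<subseteq> Points"
      using lm \<sigma>(2) by (auto simp: Lines_def points_in_def)
    have "card (N ` l \<inter> N ` image recip ` m) = card (N ` (l \<inter> image recip ` m))"
      using inj_on_image_Int[OF N sub] by simp
    also have "\<dots> \<le> card (l \<inter> image recip ` m)"
      using sub finite_Points by (intro card_image_le) (auto intro: finite_subset)
    also have "\<dots> \<le> 2" by (rule orthogoval_lines[OF lm])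
    finally show ?thesis .
  qed
  then have "orthogoval (N ` Points) ?L ?L'"
    using d d' unfolding orthogoval_def desarguesian_plane_of_order_def by blast
  then show ?thesis using d d' by blast
qed

end
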